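(* Let $d,m$ be positive integers, let $n=(2dm-1)(d+1)+1$, and let $T_1,T_2,\ldots,T_n$ be subsets of $\mathbb{R}^d$ such that the convex hull of each $T_i$ contains a Euclidean unit ball $B_1(c_i)$. Then one can choose points $t_1\in T_1,t_2\in T_2,\ldots,t_n\in T_n$ and a partition of the (indexed) collection $t_1,t_2,\ldots,t_n$ into $m$ parts $A_1,A_2,\ldots,A_m$ (that is, a partition $I_1,\ldots,I_m$ of $\{1,\ldots,n\}$ with $A_k=\{t_i:i\in I_k\}$) such that the intersection $$\bigcap_{k=1}^m\operatorname{conv}A_k$$ contains a ball of radius $(\pi/e^2)\,d^{-2d-2}$. Moreover, let $\varepsilon>0$ and $n'=n^{\mathrm{bms}}(d,\varepsilon)$. If instead of the $n$ above one takes $$n=\bigl(m[(n'-1)d+1]-1\bigr)(d+1)+1,$$ then, for any subsets $T_1,\ldots,T_n$ of $\mathbb{R}^d$ such that the convex hull of each $T_i$ contains a Euclidean unit ball, one can choose points $t_i\in T_i$ $(1\le i\le n)$ and a partition of them into $m$ parts $A_1,\ldots,A_m$ (in the same sense) such that $\bigcap_{k=1}^m\operatorname{conv}A_k$ contains a ball of radius $(1+\varepsilon)^{-1}$.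
   Context: $B_r(p)\subset\mathbb{R}^d$ denotes the closed Euclidean ball of radius $r$ with center $p$. For a positive integer $d$ and $\varepsilon>0$, $n^{\mathrm{bms}}(d,\varepsilon)$ denotes the smallest integer such that, for any compact convex set $K\subset\mathbb{R}^d$ that is centrally symmetric about the origin, has positive volume and has $C^2$ boundary, there is a polytope $P$ with at most $n^{\mathrm{bms}}(d,\varepsilon)$ vertices and an invertible linear transformation $\lambda:\mathbb{R}^d\to\mathbb{R}^d$ such that $P\subset\lambda(K)\subset(1+\varepsilon)P$, where $(1+\varepsilon)P=\{(1+\varepsilon)x:x\in P\}$. A polytope is the convex hull of finitely many points; $\operatorname{conv}$ is the convex hull. *)

theory Defs
  imports "HOL-Analysis.Analysis"
begin

definition C2_on :: "('a::real_normed_vector \<Rightarrow> real) \<Rightarrow> 'a set \<Rightarrow> bool" where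
  "C2_on f U \<longleftrightarrow>
     (\<exists>(f' :: 'a \<Rightarrow> 'a \<Rightarrow>\<^sub>L real) (f'' :: 'a \<Rightarrow> 'a \<Rightarrow>\<^sub>L 'a \<Rightarrow>\<^sub>L real).
        (\<forall>x\<in>U. (f has_derivative blinfun_apply (f' x)) (at x)) \<and>
        (\<forall>x\<in>U. (f' has_derivative blinfun_apply (f'' x)) (at x)) \<and>
        continuous_on U f'')"

text \<open>The boundary of \<open>K\<close> is an embedded hypersurface of class \<open>C\<^sup>2\<close>: locally it is a regular
  level set of a \<open>C\<^sup>2\<close> function.\<close>

definition C2_boundary :: "'a::real_normed_vector set \<Rightarrow> bool" where
  "C2_boundary K \<longleftrightarrow>
     (\<forall>p\<in>frontier K. \<exists>U f. open U \<and> p \<in> U \<and> C2_on f U \<and>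
        (\<forall>x\<in>U. frechet_derivative f (at x) \<noteq> (\<lambda>_. 0)) \<and>
        frontier K \<inter> U = {x \<in> U. f x = 0})"

text \<open>The vertices of a polytope are its extreme points; a polytope has only finitely many, so
  the cardinality below is meaningful. The type argument \<open>'d\<close> carries the dimension
  \<open>d = CARD('d)\<close>. Vertex numbers are nonnegative, so the smallest integer is a
  natural number; for \<open>\<epsilon> > 0\<close> some such \<open>N\<close> exists, so the minimum is attained.\<close>

definition n_bms :: "'d::finite itself \<Rightarrow> real \<Rightarrow> nat" where
  "n_bms (_ :: 'd itself) \<epsilon> =
     (LEAST N. \<forall>K :: (real ^ 'd) set.
        compact K \<and> convex K \<and> (\<forall>x\<in>K. - x \<in> K) \<and> 0 < measure lebesgue K \<and> C2_boundary K \<longrightarrow>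
        (\<exists>(P :: (real ^ 'd) set) (\<Lambda> :: real ^ 'd \<Rightarrow> real ^ 'd).
           polytope P \<and> card {v. v extreme_point_of P} \<le> N \<and>
           linear \<Lambda> \<and> bij \<Lambda> \<and>
           P \<subseteq> \<Lambda> ` K \<and> \<Lambda> ` K \<subseteq> (\<lambda>x. (1 + \<epsilon>) *\<^sub>R x) ` P))"

end

theory Submission
  imports Defs
begin

text \<open>
  Tverberg's theorem for the centres of the balls gives \<open>m * q\<close> classes with a common point \<open>p\<close>. The
  weighted Minkowski sum of the sets of one class, with the weights that represent \<open>p\<close>, has a convex hull
  containing the unit ball around \<open>p\<close>, and a point of this sum is a convex combination of one
  point from each set of the class. This reduces the theorem to selecting one point from each of \<open>q\<close> sets whose
  hulls contain the unit ball around 0 so that the selected points still enclose a ball around 0.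

  In the second part this ball is enclosed by an approximating polytope of the unit ball: one vertex is
  covered by a single selected point after a rotation, every other vertex by \<open>d\<close> points and the
  colourful Caratheodory theorem with a prescribed base point. In the first part, the same argument with a
  simplex replaces each set by \<open>d\<^sup>2 + 1\<close> points enclosing a ball of radius \<open>1 / (2 d)\<close>; then \<open>d\<close> sets are used to
  contain a point far from all hyperplanes spanned by \<open>d - 1\<close> of these points, and \<open>d\<close> sets to contain
  a point in the opposite direction.
\<close>

section \<open>Linear relations and weights\<close>

text \<open>The obstacle is quantitative: colourful Caratheodory catches a single point, possibly by
  a choice lying in a hyperplane, while the conclusion needs depth. Covering the vertices of a
  polytope gives depth at the price of \<open>d\<close> colours per vertex. With only
  \<open>2 * d\<close> colours, depth has to come from the position of one point. Reducing every set
  to \<open>f\<close> points leaves finitely many hyperplanes to avoid: an omitted colour and a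
  choice from the \<open>d - 1\<close> others give at most \<open>d * f ^ (d - 1)\<close> of them,
  and Bang's vector keeps distance \<open>w\<close> from all of them at norm at most
  \<open>w\<close> times their number. With \<open>f = d * d + 1\<close> the radius becomes 1 / ((4
  d + 1) d (d^2 + 1)^(d - 1)), at least the stated one for d \<ge> 2. Both values of
  \<open>n\<close> are (m q - 1)(d + 1) + 1, the Tverberg number for m q classes, where
  \<open>q\<close> counts the colours that one part consumes: 2 d, or (n' - 1) d + 1.\<close>

lemma underdetermined_system:
  fixes b :: "'j \<Rightarrow> 'i \<Rightarrow> real"
  assumes "finite I" "finite J" "card I < card J"
  shows "\<exists>\<gamma>. (\<exists>j\<in>J. \<gamma> j \<noteq> 0) \<and> (\<forall>i\<in>I. (\<Sum>j\<in>J. \<gamma> j * b j i) = 0)"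
  using assms
proof (induction I arbitrary: J b rule: finite_induct)
  case empty
  then have "J \<noteq> {}" by auto
  then show ?case by (intro exI[of _ "\<lambda>_. 1"]) auto
next
  case (insert i0 I)
  show ?case
  proof (cases "\<forall>j\<in>J. b j i0 = 0")
    case True
    obtain \<gamma> where "\<exists>j\<in>J. \<gamma> j \<noteq> 0" "\<forall>i\<in>I. (\<Sum>j\<in>J. \<gamma> j * b j i) = 0"
      using insert.IH[of J b] insert.prems insert.hyps by auto
    with True show ?thesis by (intro exI[of _ \<gamma>]) auto
  next
    case False
    then obtain j0 where j0: "j0 \<in> J" "b j0 i0 \<noteq> 0" by auto
    define J' where "J' = J - {j0}"
    have J': "finite J'" "card I < card J'" "j0 \<notin> J'" "J = insert j0 J'"
      using insert.prems insert.hyps j0 by (auto simp: J'_def)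
    obtain \<gamma> where \<gamma>: "\<exists>j\<in>J'. \<gamma> j \<noteq> 0"
      "\<forall>i\<in>I. (\<Sum>j\<in>J'. \<gamma> j * (b j i - b j i0 / b j0 i0 * b j0 i)) = 0"
      using insert.IH[of J' "\<lambda>j i. b j i - b j i0 / b j0 i0 * b j0 i"] J' by auto
    \<comment> \<open>Gaussian elimination: the reduced vectors have coordinate 0 at
      \<open>i0\<close>, and the weight of the pivot \<open>j0\<close> is the one that turns a
      relation among them into a relation among the original vectors.\<close>
    define \<delta> where "\<delta> = \<gamma>(j0 := - (\<Sum>j\<in>J'. \<gamma> j * b j i0) / b j0 i0)"
    have sum: "(\<Sum>j\<in>J. \<delta> j * b j i)
        = (\<Sum>j\<in>J'. \<gamma> j * (b j i - b j i0 / b j0 i0 * b j0 i))" for i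
    proof -
      have "(\<Sum>j\<in>J. \<delta> j * b j i) = \<delta> j0 * b j0 i + (\<Sum>j\<in>J'. \<delta> j * b j i)"
        using J' by simp
      also have "(\<Sum>j\<in>J'. \<delta> j * b j i) = (\<Sum>j\<in>J'. \<gamma> j * b j i)"
        using J' by (intro sum.cong) (auto simp: \<delta>_def)
      finally show ?thesis
        by (simp add: \<delta>_def algebra_simps sum_subtractf sum_distrib_left sum_divide_distrib)
    qed
    have "(\<Sum>j\<in>J'. \<gamma> j * (b j i0 - b j i0 / b j0 i0 * b j0 i0)) = 0"
      using j0 by simp
    with sum \<gamma>(2) have "\<forall>i\<in>insert i0 I. (\<Sum>j\<in>J. \<delta> j * b j i) = 0" by simp
    moreover have "\<exists>j\<in>J. \<delta> j \<noteq> 0" using \<gamma>(1) J' by (auto simp: \<delta>_def)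
    ultimately show ?thesis by blast
  qed
qed

text \<open>The exchange step of Caratheodory's theorem: along a linear relation
  \<open>\<gamma>\<close> the represented vector does not change, and the least ratio
  \<open>\<beta> j / \<gamma> j\<close> is the moment when a weight reaches 0.\<close>

lemma nonneg_weights_reduce:
  fixes \<beta> \<gamma> :: "'j \<Rightarrow> real"
  assumes "finite J" "\<forall>j\<in>J. 0 \<le> \<beta> j" "\<exists>j\<in>J. 0 < \<gamma> j"
  obtains t where "\<forall>j\<in>J. 0 \<le> \<beta> j - t * \<gamma> j" "\<exists>j\<in>J. \<gamma> j > 0 \<and> \<beta> j - t * \<gamma> j = 0"
proof -
  define P where "P = {j\<in>J. 0 < \<gamma> j}"
  have P: "finite P" "P \<noteq> {}" using assms by (auto simp: P_def)
  define t where "t = Min ((\<lambda>j. \<beta> j / \<gamma> j) ` P)"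
  have "t \<in> (\<lambda>j. \<beta> j / \<gamma> j) ` P" unfolding t_def using P by (intro Min_in) auto
  then obtain j0 where j0: "j0 \<in> P" "t = \<beta> j0 / \<gamma> j0" by auto
  have tle: "t \<le> \<beta> j / \<gamma> j" if "j \<in> P" for j
    unfolding t_def using P that by (intro Min_le) auto
  have t0: "0 \<le> t" using j0 assms by (auto simp: P_def)
  show thesis
  proof (rule that[of t])
    show "\<forall>j\<in>J. 0 \<le> \<beta> j - t * \<gamma> j"
    proof
      fix j assume j: "j \<in> J"
      show "0 \<le> \<beta> j - t * \<gamma> j"
      proof (cases "0 < \<gamma> j")
        case True
        then show ?thesis using tle[of j] j by (simp add: P_def pos_le_divide_eq)
      next
        case False
        then have "t * \<gamma> j \<le> 0" using t0 by (simp add: mult_nonneg_nonpos)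
        then show ?thesis using assms(2) j by force
      qed
    qed
    show "\<exists>j\<in>J. \<gamma> j > 0 \<and> \<beta> j - t * \<gamma> j = 0"
      using j0 by (auto simp: P_def)
  qed
qed

text \<open>First variation at a minimum: the right-hand side is the change of a squared norm after
  a step of length \<open>e\<close>.\<close>

lemma nonneg_of_quadratic:
  fixes x y :: real
  assumes "\<And>e. 0 < e \<Longrightarrow> e \<le> 1 \<Longrightarrow> 0 \<le> 2 * e * x + e\<^sup>2 * y"
  shows "0 \<le> x"
proof (rule ccontr)
  assume "\<not> 0 \<le> x"
  then have x: "x < 0" by simp
  define e where "e = min 1 (- x / (\<bar>y\<bar> + 1))"
  have e: "0 < e" "e \<le> 1" using x by (auto simp: e_def intro!: divide_neg_pos)
  have "e * (\<bar>y\<bar> + 1) \<le> - x"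
    using pos_le_divide_eq[of "\<bar>y\<bar> + 1" e "- x"] e_def min.cobounded2[of 1 "- x / (\<bar>y\<bar> + 1)"]
    by linarith
  then have "e * y \<le> - x" using e abs_ge_self[of y]
    by (smt (verit, best) mult_left_mono)
  then have "2 * x + e * y < 0" using x by simp
  then have "e * (2 * x + e * y) < 0" using e by (simp add: mult_pos_neg)
  then show False using assms[OF e] by (simp add: power2_eq_square algebra_simps)
qed

text \<open>Weights are functions on the whole index type, set to 0 outside \<open>J\<close>, so
  that the simplex is a closed subset of a product of unit intervals.\<close>

lemma compact_weights:
  assumes "finite J"
  shows "compact {\<alpha> :: 'j \<Rightarrow> real. (\<forall>j. 0 \<le> \<alpha> j) \<and> (\<forall>j. j \<notin> J \<longrightarrow> \<alpha> j = 0) \<and> sum \<alpha> J = 1}"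
    (is "compact ?D")
proof -
  define B where "B = PiE (UNIV :: 'j set) (\<lambda>_. {0..1::real})"
  have "compactin (product_topology (\<lambda>_::'j. euclideanreal) UNIV) B"
    unfolding B_def by (subst compactin_PiE) auto
  then have B: "compact B" by (simp add: euclidean_product_topology)
  have cl: "closed ?D"
  proof -
    have "closed {\<alpha> :: 'j \<Rightarrow> real. 0 \<le> \<alpha> j}" for j
      by (intro closed_Collect_le continuous_intros continuous_on_product_coordinates)
    moreover have "closed {\<alpha> :: 'j \<Rightarrow> real. \<alpha> j = 0}" for j
      by (intro closed_Collect_eq continuous_intros continuous_on_product_coordinates)
    moreover have "closed {\<alpha> :: 'j \<Rightarrow> real. sum \<alpha> J = 1}"
      by (intro closed_Collect_eq continuous_intros continuous_on_product_coordinates)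
    ultimately show ?thesis
      by (intro closed_Collect_conj closed_Collect_all)
         (auto simp: closed_Collect_imp)
  qed
  have "?D \<subseteq> B"
  proof
    fix \<alpha> assume a: "\<alpha> \<in> ?D"
    have "\<alpha> j \<le> 1" for j
    proof (cases "j \<in> J")
      case True
      then have "\<alpha> j \<le> sum \<alpha> J" using a assms by (intro member_le_sum) auto
      then show ?thesis using a by simp
    qed (use a in auto)
    then show "\<alpha> \<in> B" using a by (auto simp: B_def)
  qed
  then show ?thesis using B cl compact_Int_closed[of B ?D] by (simp add: Int_absorb1)
qed

section \<open>Tverberg's theorem\<close>

text \<open>Barany's argument: \<open>z\<close> is the point nearest to 0 over all choices and
  weights. If it is not 0, some colour can be spared in its representation, and by
  \<open>sep\<close> that colour has a vector not beyond the hyperplane through 0 orthogonal to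
  \<open>z\<close>; replacing it brings the hull closer to 0. The hypothesis \<open>sep\<close> is
  the dual form of 0 lying in the hull of each class.\<close>

lemma colourful_caratheodory_coords:
  fixes b :: "'j \<Rightarrow> 'k \<Rightarrow> 'i \<Rightarrow> real"
  assumes I: "finite I" and J: "finite J" and K: "finite K" and IJ: "card I < card J"
    and sep: "\<And>j z. j \<in> J \<Longrightarrow> \<exists>k\<in>K. (\<Sum>i\<in>I. b j k i * z i) \<le> 0"
  shows "\<exists>\<kappa> \<alpha>. \<kappa> \<in> J \<rightarrow> K \<and> (\<forall>j\<in>J. 0 \<le> \<alpha> j) \<and> sum \<alpha> J = 1 \<and>
           (\<forall>i\<in>I. (\<Sum>j\<in>J. \<alpha> j * b j (\<kappa> j) i) = 0)"
proof -
  define D :: "('j \<Rightarrow> real) set" where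
    "D = {\<alpha>. (\<forall>j. 0 \<le> \<alpha> j) \<and> (\<forall>j. j \<notin> J \<longrightarrow> \<alpha> j = 0) \<and> sum \<alpha> J = 1}"
  define f where "f \<kappa> \<alpha> = (\<Sum>i\<in>I. (\<Sum>j\<in>J. \<alpha> j * b j (\<kappa> j) i)\<^sup>2)" for \<kappa> :: "'j \<Rightarrow> 'k" and \<alpha>
  obtain j1 where j1: "j1 \<in> J" using IJ by fastforce
  have D_ne: "D \<noteq> {}"
  proof -
    have "(\<lambda>j. if j = j1 then 1 else 0) \<in> D" using j1 J by (auto simp: D_def)
    then show ?thesis by blast
  qed
  have K_ne: "K \<noteq> {}" using sep[OF j1] by blast
  have ex_min: "\<exists>\<alpha>\<in>D. \<forall>\<alpha>'\<in>D. f \<kappa> \<alpha> \<le> f \<kappa> \<alpha>'" for \<kappa>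
  proof (rule continuous_attains_inf)
    show "compact D" unfolding D_def using J by (rule compact_weights)
    show "continuous_on D (f \<kappa>)"
      unfolding f_def
      by (intro continuous_intros continuous_on_subset[OF continuous_on_product_coordinates]) auto
  qed (rule D_ne)
  then obtain A where A: "\<And>\<kappa>. A \<kappa> \<in> D" "\<And>\<kappa> \<alpha>. \<alpha> \<in> D \<Longrightarrow> f \<kappa> (A \<kappa>) \<le> f \<kappa> \<alpha>"
    by metis
  define E where "E = PiE J (\<lambda>_. K)"
  have E: "finite E" "E \<noteq> {}" using J K K_ne by (auto simp: E_def finite_PiE PiE_eq_empty_iff)
  then obtain \<kappa> where \<kappa>: "\<kappa> \<in> E" "\<And>\<kappa>'. \<kappa>' \<in> E \<Longrightarrow> f \<kappa> (A \<kappa>) \<le> f \<kappa>' (A \<kappa>')"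
    using ex_is_arg_min_if_finite[OF E, of "\<lambda>\<kappa>. f \<kappa> (A \<kappa>)"]
    by (auto simp: is_arg_min_linorder)
  define \<alpha> where "\<alpha> = A \<kappa>"
  have \<alpha>: "\<alpha> \<in> D" by (simp add: \<alpha>_def A)
  define z where "z i = (\<Sum>j\<in>J. \<alpha> j * b j (\<kappa> j) i)" for i
  define q where "q = (\<Sum>i\<in>I. (z i)\<^sup>2)"
  have q: "f \<kappa> \<alpha> = q" by (simp add: f_def q_def z_def)
  have min: "q \<le> f \<kappa>' \<alpha>'" if "\<kappa>' \<in> E" "\<alpha>' \<in> D" for \<kappa>' \<alpha>'
    using \<kappa>(2)[OF that(1)] A(2)[OF that(2), of \<kappa>'] q by (simp add: \<alpha>_def)
  have q0: "0 \<le> q" by (auto simp: q_def intro: sum_nonneg)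
  \<comment> \<open>minimality along the segment from \<open>z\<close> to \<open>b j0 k\<close>, which lies in the hull of an admissible choice\<close>
  have move: "q \<le> (\<Sum>i\<in>I. b j0 k i * z i)"
    if \<alpha>': "\<alpha>' \<in> D" and rep: "\<And>i. i \<in> I \<Longrightarrow> (\<Sum>j\<in>J. \<alpha>' j * b j (\<kappa> j) i) = z i"
      and j0: "j0 \<in> J" and k: "k \<in> K" and or: "k = \<kappa> j0 \<or> \<alpha>' j0 = 0" for \<alpha>' j0 k
  proof -
    define x y where "x = (\<Sum>i\<in>I. z i * (b j0 k i - z i))"
      and "y = (\<Sum>i\<in>I. (b j0 k i - z i)\<^sup>2)"
    have "0 \<le> 2 * e * x + e\<^sup>2 * y" if e: "0 < e" "e \<le> 1" for e
    proof -
      define \<kappa>' where "\<kappa>' = \<kappa>(j0 := k)"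
      define \<alpha>2 where "\<alpha>2 j = (1 - e) * \<alpha>' j + (if j = j0 then e else 0)" for j
      have "\<alpha>2 \<in> D" using \<alpha>' e j0 J
        by (auto simp: D_def \<alpha>2_def sum.distrib sum_distrib_left[symmetric])
      moreover have "\<kappa>' \<in> E" using \<kappa>(1) j0 k by (auto simp: E_def \<kappa>'_def PiE_def extensional_def)
      ultimately have "q \<le> f \<kappa>' \<alpha>2" by (rule min[rotated])
      also have "f \<kappa>' \<alpha>2 = (\<Sum>i\<in>I. (z i + e * (b j0 k i - z i))\<^sup>2)"
        unfolding f_def
      proof (intro sum.cong refl)
        fix i assume i: "i \<in> I"
        have "(\<Sum>j\<in>J. \<alpha>2 j * b j (\<kappa>' j) i) =
            (\<Sum>j\<in>J. (1 - e) * (\<alpha>' j * b j (\<kappa> j) i) + (if j = j0 then e * b j0 k i else 0))"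
          using or by (intro sum.cong) (auto simp: \<alpha>2_def \<kappa>'_def algebra_simps)
        also have "\<dots> = (1 - e) * z i + e * b j0 k i"
          using J j0 rep[OF i] by (simp add: sum.distrib sum_distrib_left[symmetric])
        also have "\<dots> = z i + e * (b j0 k i - z i)" by (simp add: algebra_simps)
        finally show "(\<Sum>j\<in>J. \<alpha>2 j * b j (\<kappa>' j) i)\<^sup>2 = (z i + e * (b j0 k i - z i))\<^sup>2"
          by simp
      qed
      also have "\<dots> = q + 2 * e * x + e\<^sup>2 * y"
        by (simp add: q_def x_def y_def power2_sum power_mult_distrib sum.distrib
            sum_distrib_left mult_ac)
      finally show ?thesis by simp
    qed
    then have "0 \<le> x" by (rule nonneg_of_quadratic)
    then show ?thesis
      by (simp add: x_def q_def right_diff_distrib sum_subtractf power2_eq_square mult_ac)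
  qed
  have "q = 0"
  proof (rule ccontr)
    assume "q \<noteq> 0"
    with q0 have qpos: "0 < q" by simp
    define p where "p j = (\<Sum>i\<in>I. b j (\<kappa> j) i * z i)" for j
    have pq: "q \<le> p j" if "j \<in> J" for j
      unfolding p_def using \<kappa>(1) that by (intro move[OF \<alpha>]) (auto simp: E_def z_def)
    have "(\<Sum>j\<in>J. \<alpha> j * p j) = (\<Sum>i\<in>I. \<Sum>j\<in>J. \<alpha> j * b j (\<kappa> j) i * z i)"
      unfolding p_def sum_distrib_left by (subst sum.swap) (simp add: mult_ac)
    also have "\<dots> = q"
      by (simp add: q_def power2_eq_square z_def sum_distrib_right)
    finally have "(\<Sum>j\<in>J. \<alpha> j * (p j - q)) = 0"
      using \<alpha> by (simp add: D_def right_diff_distrib sum_subtractf sum_distrib_right[symmetric])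
    \<comment> \<open>Complementary slackness: the weighted mean of \<open>p\<close> is
      \<open>q\<close> and no \<open>p j\<close> is below \<open>q\<close>.\<close>
    then have supp: "\<alpha> j * (p j - q) = 0" if "j \<in> J" for j
      using sum_nonneg_eq_0_iff[OF J, of "\<lambda>j. \<alpha> j * (p j - q)"] pq \<alpha> that
      by (auto simp: D_def)
    obtain \<alpha>' j0 where \<alpha>': "\<alpha>' \<in> D" and j0: "j0 \<in> J" "\<alpha>' j0 = 0"
      and rep: "\<And>i. i \<in> I \<Longrightarrow> (\<Sum>j\<in>J. \<alpha>' j * b j (\<kappa> j) i) = z i"
    proof (cases "\<exists>j\<in>J. \<alpha> j = 0")
      case True
      then show ?thesis using \<alpha> that by (auto simp: z_def)
    next
      case False
      then have p: "p j = q" if "j \<in> J" for j using supp that by fastforce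
      obtain \<gamma> where \<gamma>: "\<exists>j\<in>J. \<gamma> j \<noteq> 0" "\<forall>i\<in>I. (\<Sum>j\<in>J. \<gamma> j * b j (\<kappa> j) i) = 0"
        using underdetermined_system[OF I J IJ, of "\<lambda>j i. b j (\<kappa> j) i"] by blast
      \<comment> \<open>All chosen vectors lie on the hyperplane where the pairing with
        \<open>z\<close> equals \<open>q > 0\<close>. Pairing the linear relation with
        \<open>z\<close> therefore shows that its coefficients sum to 0, and the exchange keeps the
        total weight 1.\<close>
      have "(\<Sum>j\<in>J. \<gamma> j) * q = (\<Sum>j\<in>J. \<gamma> j * p j)"
        by (simp add: sum_distrib_right p)
      also have "\<dots> = (\<Sum>i\<in>I. (\<Sum>j\<in>J. \<gamma> j * b j (\<kappa> j) i) * z i)"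
        unfolding p_def sum_distrib_left sum_distrib_right
        by (subst sum.swap) (simp add: mult_ac)
      also have "\<dots> = 0" using \<gamma> by simp
      finally have \<gamma>0: "sum \<gamma> J = 0" using qpos by simp
      have "\<exists>j\<in>J. 0 < \<gamma> j"
      proof (rule ccontr)
        assume "\<not> ?thesis"
        then have "\<forall>j\<in>J. \<gamma> j \<le> 0" by (auto simp: not_less)
        then show False using sum_nonneg_eq_0_iff[OF J, of "\<lambda>j. - \<gamma> j"] \<gamma>0 \<gamma>(1)
          by (auto simp: sum_negf)
      qed
      moreover have "\<forall>j\<in>J. 0 \<le> \<alpha> j" using \<alpha> by (simp add: D_def)
      ultimately obtain t where t: "\<forall>j\<in>J. 0 \<le> \<alpha> j - t * \<gamma> j" "\<exists>j\<in>J. \<alpha> j - t * \<gamma> j = 0"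
        using nonneg_weights_reduce[OF J] by metis
      define \<alpha>' where "\<alpha>' j = (if j \<in> J then \<alpha> j - t * \<gamma> j else 0)" for j
      have "\<alpha>' \<in> D" using t(1) \<gamma>0 \<alpha>
        by (auto simp: D_def \<alpha>'_def sum_subtractf sum_distrib_left[symmetric])
      moreover have "(\<Sum>j\<in>J. \<alpha>' j * b j (\<kappa> j) i) = z i" if "i \<in> I" for i
      proof -
        have "(\<Sum>j\<in>J. \<alpha>' j * b j (\<kappa> j) i)
            = (\<Sum>j\<in>J. \<alpha> j * b j (\<kappa> j) i) - t * (\<Sum>j\<in>J. \<gamma> j * b j (\<kappa> j) i)"
          unfolding sum_distrib_left sum_subtractf[symmetric]
          by (intro sum.cong) (auto simp: \<alpha>'_def algebra_simps)
        then show ?thesis using \<gamma>(2) that by (simp add: z_def)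
      qed
      moreover obtain j0 where "j0 \<in> J" "\<alpha>' j0 = 0" using t(2) by (auto simp: \<alpha>'_def)
      ultimately show ?thesis using that by blast
    qed
    obtain k where "k \<in> K" "(\<Sum>i\<in>I. b j0 k i * z i) \<le> 0" using sep[OF j0(1)] by blast
    then show False using move[OF \<alpha>' rep j0(1), of k] j0(2) qpos by force
  qed
  then have "\<forall>i\<in>I. z i = 0" using I by (simp add: q_def sum_nonneg_eq_0_iff)
  then show ?thesis using \<alpha> \<kappa>(1)
    by (intro exI[of _ \<kappa>] exI[of _ \<alpha>]) (auto simp: D_def z_def E_def)
qed

text \<open>Sarkaria's reduction: lift \<open>c i\<close> to \<open>(c i, 1)\<close> and tensor it with the vectors
  \<open>w\<^sub>0 = -(1,\<dots>,1), w\<^sub>l = e\<^sub>l\<close> of \<open>\<real>\<^sup>r\<^sup>-\<^sup>1\<close>, whose only linear relation is that they sum to zero.\<close>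

theorem tverberg:
  fixes c :: "'i \<Rightarrow> 'a::euclidean_space"
  assumes N: "finite N" and r: "0 < r" and card: "(r - 1) * (DIM('a) + 1) < card N"
  obtains k p \<mu> where "k \<in> N \<rightarrow> {..<r::nat}" "\<And>i. i \<in> N \<Longrightarrow> 0 \<le> \<mu> i"
    "\<And>l. l < r \<Longrightarrow> (\<Sum>i | i \<in> N \<and> k i = l. \<mu> i) = 1"
    "\<And>l. l < r \<Longrightarrow> (\<Sum>i | i \<in> N \<and> k i = l. \<mu> i *\<^sub>R c i) = p"
proof -
  \<comment> \<open>\<open>None\<close> is the coordinate of the appended 1. The pairs index a space
    of dimension (d + 1)(r - 1), the bound that \<open>card N\<close> has to exceed.\<close>
  define I :: "('a option \<times> nat) set" where "I = insert None (Some ` Basis) \<times> {1..<r}"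
  define a where "a i e = (case e of None \<Rightarrow> 1 | Some e \<Rightarrow> c i \<bullet> e)" for i and e :: "'a option"
  define w where "w k l = (if k = 0 then - 1 else if k = l then 1 else 0 :: real)" for k l :: nat
  define b where "b i k = (\<lambda>(e, l). a i e * w k l)" for i k
  have w0: "(\<Sum>k<r. w k l) = 0" if "l \<in> {1..<r}" for l
  proof -
    have "(\<Sum>k<r. w k l) = (\<Sum>k<r. (if k = l then 1 else 0) - (if k = 0 then 1 else 0))"
      using that by (intro sum.cong) (auto simp: w_def)
    also have "\<dots> = 0" using that by (simp add: sum_subtractf)
    finally show ?thesis .
  qed
  have "\<exists>\<kappa> \<alpha>. \<kappa> \<in> N \<rightarrow> {..<r} \<and> (\<forall>j\<in>N. 0 \<le> \<alpha> j) \<and> sum \<alpha> N = 1 \<and>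
           (\<forall>i\<in>I. (\<Sum>j\<in>N. \<alpha> j * b j (\<kappa> j) i) = 0)"
  proof (rule colourful_caratheodory_coords)
    show "finite I" by (simp add: I_def)
    have "card (insert None (Some ` (Basis::'a set))) = DIM('a) + 1"
      by (subst card_insert_disjoint) (auto simp: card_image)
    then show "card I < card N" using card by (simp add: I_def card_cartesian_product mult.commute)
    fix j and z :: "'a option \<times> nat \<Rightarrow> real"
    have "(\<Sum>k<r. \<Sum>i\<in>I. b j k i * z i) = (\<Sum>i\<in>I. (\<Sum>k<r. b j k i) * z i)"
      unfolding sum_distrib_right by (rule sum.swap)
    also have "\<dots> = 0"
      by (intro sum.neutral) (auto simp: I_def b_def sum_distrib_left[symmetric] w0)
    finally have "\<not> (\<forall>k<r. 0 < (\<Sum>i\<in>I. b j k i * z i))"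
      using sum_pos[of "{..<r}" "\<lambda>k. \<Sum>i\<in>I. b j k i * z i"] r by auto
    then show "\<exists>k\<in>{..<r}. (\<Sum>i\<in>I. b j k i * z i) \<le> 0" by (auto simp: not_less)
  qed (use N in auto)
  then obtain k \<alpha> where k: "k \<in> N \<rightarrow> {..<r}" and \<alpha>: "\<And>i. i \<in> N \<Longrightarrow> 0 \<le> \<alpha> i" "sum \<alpha> N = 1"
    and eq: "\<And>i. i \<in> I \<Longrightarrow> (\<Sum>j\<in>N. \<alpha> j * b j (k j) i) = 0" by blast
  define Z where "Z l e = (\<Sum>i | i \<in> N \<and> k i = l. \<alpha> i * a i e)" for l e
  \<comment> \<open>In the tensor coordinate \<open>l\<close> only the classes \<open>l\<close> and
    0 contribute, with opposite signs; its vanishing equates their sums.\<close>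
  have Z: "Z l e = Z 0 e" if l: "l < r" and e: "e \<in> insert None (Some ` Basis)" for l e
  proof (cases "l = 0")
    case False
    with l e have "(e, l) \<in> I" by (auto simp: I_def)
    from eq[OF this] have "0 = (\<Sum>j\<in>N. \<alpha> j * a j e * w (k j) l)" by (simp add: b_def mult_ac)
    also have "\<dots> = (\<Sum>j\<in>N. (if k j = l then \<alpha> j * a j e else 0)
        - (if k j = 0 then \<alpha> j * a j e else 0))"
      using False by (intro sum.cong) (auto simp: w_def)
    also have "\<dots> = Z l e - Z 0 e"
      using N by (simp add: Z_def sum_subtractf sum.inter_filter[symmetric])
    finally show ?thesis by simp
  qed simp
  \<comment> \<open>The \<open>r\<close> classes have equal weight and total weight 1, so
    multiplication by \<open>r\<close> normalises each of them.\<close>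
  have "(\<Sum>l<r. Z l None) = sum \<alpha> N"
    unfolding Z_def a_def using N k sum.group[of N "{..<r}" k \<alpha>] by (auto simp: image_subset_iff_funcset)
  also have "(\<Sum>l<r. Z l None) = (\<Sum>l<r. Z 0 None)"
    by (rule sum.cong[OF refl], rule Z) auto
  finally have rZ: "r * Z 0 None = 1" using \<alpha> by simp
  define p where "p = (\<Sum>i | i \<in> N \<and> k i = 0. (r * \<alpha> i) *\<^sub>R c i)"
  show thesis
  proof (rule that[of k "\<lambda>i. r * \<alpha> i" p])
    fix l assume l: "l < r"
    have "(\<Sum>i | i \<in> N \<and> k i = l. r * \<alpha> i) = r * Z l None"
      by (simp add: Z_def a_def sum_distrib_left)
    then show "(\<Sum>i | i \<in> N \<and> k i = l. r * \<alpha> i) = 1" using Z[OF l, of None] rZ by simp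
    show "(\<Sum>i | i \<in> N \<and> k i = l. (r * \<alpha> i) *\<^sub>R c i) = p"
    proof (rule euclidean_eqI)
      fix e :: 'a assume e: "e \<in> Basis"
      have *: "(\<Sum>i | i \<in> N \<and> k i = l. (r * \<alpha> i) *\<^sub>R c i) \<bullet> e = r * Z l (Some e)" for l
        by (simp add: Z_def a_def inner_sum_left sum_distrib_left mult_ac)
      show "(\<Sum>i | i \<in> N \<and> k i = l. (r * \<alpha> i) *\<^sub>R c i) \<bullet> e = p \<bullet> e"
        unfolding p_def * using Z[OF l, of "Some e"] e by simp
    qed
  qed (use k \<alpha> in auto)
qed

section \<open>Colourful Caratheodory theorems in Euclidean space\<close>

text \<open>Weights are attached to the indices, not to the points, since two colours may select the
  same point.\<close>

lemma convex_hull_finite_image: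
  fixes s :: "'j \<Rightarrow> 'a::real_vector"
  assumes "finite J"
  shows "convex hull (s ` J) =
    {\<Sum>j\<in>J. \<beta> j *\<^sub>R s j | \<beta>. (\<forall>j\<in>J. 0 \<le> \<beta> j) \<and> sum \<beta> J = 1}" (is "_ = ?R")
proof
  show "convex hull (s ` J) \<subseteq> ?R"
  proof (rule hull_minimal)
    show "s ` J \<subseteq> ?R"
    proof clarify
      fix j assume j: "j \<in> J"
      show "\<exists>\<beta>. s j = (\<Sum>j\<in>J. \<beta> j *\<^sub>R s j) \<and> (\<forall>j\<in>J. 0 \<le> \<beta> j) \<and> sum \<beta> J = 1"
        using assms j
        by (intro exI[of _ "\<lambda>i. if i = j then 1 else 0"]) (simp add: if_distrib[of "\<lambda>x. x *\<^sub>R _"] cong: if_cong)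
    qed
    show "convex ?R"
    proof (rule convexI, clarify)
      fix \<beta> \<gamma> :: "'j \<Rightarrow> real" and u v :: real
      assume *: "0 \<le> u" "0 \<le> v" "u + v = 1" "\<forall>j\<in>J. 0 \<le> \<beta> j" "\<forall>j\<in>J. 0 \<le> \<gamma> j"
        "sum \<beta> J = 1" "sum \<gamma> J = 1"
      then show "\<exists>\<delta>. u *\<^sub>R (\<Sum>j\<in>J. \<beta> j *\<^sub>R s j) + v *\<^sub>R (\<Sum>j\<in>J. \<gamma> j *\<^sub>R s j) = (\<Sum>j\<in>J. \<delta> j *\<^sub>R s j)
          \<and> (\<forall>j\<in>J. 0 \<le> \<delta> j) \<and> sum \<delta> J = 1"
        by (intro exI[of _ "\<lambda>j. u * \<beta> j + v * \<gamma> j"])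
           (simp add: scaleR_add_left sum.distrib scaleR_sum_right sum_distrib_left[symmetric])
    qed
  qed
  show "?R \<subseteq> convex hull (s ` J)"
  proof clarify
    fix \<beta> :: "'j \<Rightarrow> real" assume "\<forall>j\<in>J. 0 \<le> \<beta> j" "sum \<beta> J = 1"
    then show "(\<Sum>j\<in>J. \<beta> j *\<^sub>R s j) \<in> convex hull (s ` J)"
      using assms by (intro convex_sum) (auto intro: hull_inc)
  qed
qed

lemma convex_cone_hull_finite_image:
  fixes s :: "'j \<Rightarrow> 'a::real_vector"
  assumes "finite J"
  shows "convex_cone hull (s ` J) = {\<Sum>j\<in>J. \<beta> j *\<^sub>R s j | \<beta>. \<forall>j\<in>J. 0 \<le> \<beta> j}" (is "_ = ?R")
proof
  show "convex_cone hull (s ` J) \<subseteq> ?R"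
  proof (rule hull_minimal)
    show "s ` J \<subseteq> ?R"
    proof clarify
      fix j assume j: "j \<in> J"
      show "\<exists>\<beta>. s j = (\<Sum>j\<in>J. \<beta> j *\<^sub>R s j) \<and> (\<forall>j\<in>J. 0 \<le> \<beta> j)"
        using assms j
        by (intro exI[of _ "\<lambda>i. if i = j then 1 else 0"]) (simp add: if_distrib[of "\<lambda>x. x *\<^sub>R _"] cong: if_cong)
    qed
    have "0 \<in> ?R" by (auto intro!: exI[of _ "\<lambda>_. 0"])
    moreover have "x + y \<in> ?R" if xy: "x \<in> ?R" "y \<in> ?R" for x y
    proof -
      obtain \<beta> \<gamma> where "x = (\<Sum>j\<in>J. \<beta> j *\<^sub>R s j)" "y = (\<Sum>j\<in>J. \<gamma> j *\<^sub>R s j)"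
        "\<forall>j\<in>J. 0 \<le> \<beta> j" "\<forall>j\<in>J. 0 \<le> \<gamma> j" using xy by blast
      then show ?thesis
        by (auto intro!: exI[of _ "\<lambda>j. \<beta> j + \<gamma> j"] simp: scaleR_add_left sum.distrib)
    qed
    moreover have "c *\<^sub>R x \<in> ?R" if "x \<in> ?R" "0 \<le> c" for x and c :: real
    proof -
      obtain \<beta> where "x = (\<Sum>j\<in>J. \<beta> j *\<^sub>R s j)" "\<forall>j\<in>J. 0 \<le> \<beta> j" using \<open>x \<in> ?R\<close> by blast
      then show ?thesis using \<open>0 \<le> c\<close>
        by (auto intro!: exI[of _ "\<lambda>j. c * \<beta> j"] simp: scaleR_sum_right)
    qed
    ultimately show "convex_cone ?R" unfolding convex_cone_iff by blast
  qed
  have "(\<Sum>j\<in>J'. \<beta> j *\<^sub>R s j) \<in> convex_cone hull (s ` J)"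
    if "J' \<subseteq> J" "\<forall>j\<in>J. 0 \<le> \<beta> j" for J' \<beta>
    using finite_subset[OF that(1) assms] that
    by (induction J' rule: finite_induct)
       (auto intro: convex_cone_hull_contains_0 convex_cone_hull_add convex_cone_hull_mul hull_inc)
  then show "?R \<subseteq> convex_cone hull (s ` J)" by blast
qed

text \<open>Because the cone contains 0 and \<open>2 z\<close>, the variational inequality of the
  nearest point holds in both directions along \<open>z\<close> and becomes orthogonality.\<close>

lemma closest_point_convex_cone:
  fixes C :: "'a::euclidean_space set"
  assumes C: "convex_cone C" "closed C" and z: "z \<in> C" "\<And>y. y \<in> C \<Longrightarrow> dist a z \<le> dist a y"
  shows "(a - z) \<bullet> z = 0" "\<And>y. y \<in> C \<Longrightarrow> (a - z) \<bullet> y \<le> 0"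
proof -
  have dot: "(a - z) \<bullet> (y - z) \<le> 0" if "y \<in> C" for y
    using any_closest_point_dot[of C z y a] C z that by (auto simp: convex_cone_def)
  have "(2::real) *\<^sub>R z \<in> C" using C(1) z(1) by (simp add: convex_cone_iff)
  from dot[OF this] have "(a - z) \<bullet> z \<le> 0" by (simp add: scaleR_2)
  moreover have "0 \<in> C" using C(1) by (simp add: convex_cone_contains_0)
  ultimately show 0: "(a - z) \<bullet> z = 0" using dot[of 0] by (simp add: inner_diff_right)
  show "(a - z) \<bullet> y \<le> 0" if "y \<in> C" for y
    using dot[OF that] 0 by (simp add: inner_diff_right)
qed

text \<open>Barany's argument for cones needs only \<open>d\<close> colours: if all weights are
  positive, the chosen vectors lie in the hyperplane orthogonal to \<open>w\<close>, so
  \<open>d\<close> of them are dependent, and a linear relation suffices because cone weights have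
  no prescribed sum.\<close>

lemma colourful_caratheodory_cone:
  fixes S :: "'j \<Rightarrow> 'a::euclidean_space set"
  assumes J: "finite J" "card J = DIM('a)"
    and S: "\<And>j. j \<in> J \<Longrightarrow> finite (S j)" "\<And>j. j \<in> J \<Longrightarrow> S j \<noteq> {}"
    and a: "\<And>j. j \<in> J \<Longrightarrow> a \<in> convex_cone hull (S j)"
  shows "\<exists>s. (\<forall>j\<in>J. s j \<in> S j) \<and> a \<in> convex_cone hull (s ` J)"
proof -
  define E where "E = PiE J S"
  have E: "finite E" "E \<noteq> {}" using J S by (auto simp: E_def finite_PiE PiE_eq_empty_iff)
  define C where "C s = convex_cone hull (s ` J)" for s :: "'j \<Rightarrow> 'a"
  have C: "convex_cone (C s)" "closed (C s)" "C s \<noteq> {}" for s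
    using J by (auto simp: C_def convex_cone_convex_cone_hull closed_convex_cone_hull convex_cone_hull_nonempty)
  have "\<exists>z\<in>C s. \<forall>y\<in>C s. dist a z \<le> dist a y" for s
    using distance_attains_inf[OF C(2,3)] by metis
  then obtain Z where Z: "\<And>s. Z s \<in> C s" "\<And>s y. y \<in> C s \<Longrightarrow> dist a (Z s) \<le> dist a y"
    by metis
  obtain s where s: "s \<in> E" "\<And>s'. s' \<in> E \<Longrightarrow> dist a (Z s) \<le> dist a (Z s')"
    using ex_is_arg_min_if_finite[OF E, of "\<lambda>s. dist a (Z s)"]
    by (auto simp: is_arg_min_linorder)
  define z w where "z = Z s" and "w = a - z"
  have wz: "w \<bullet> z = 0" and ws: "\<And>y. y \<in> C s \<Longrightarrow> w \<bullet> y \<le> 0"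
    using closest_point_convex_cone[OF C(1,2) Z, of s] by (auto simp: z_def w_def)
  have "w = 0"
  proof (rule ccontr)
    assume w: "w \<noteq> 0"
    have "z \<in> C s" by (simp add: z_def Z)
    then obtain \<beta> where \<beta>: "z = (\<Sum>j\<in>J. \<beta> j *\<^sub>R s j)" "\<forall>j\<in>J. 0 \<le> \<beta> j"
      unfolding C_def convex_cone_hull_finite_image[OF J(1)] by blast
    obtain \<beta>' j0 where \<beta>': "z = (\<Sum>j\<in>J. \<beta>' j *\<^sub>R s j)" "\<forall>j\<in>J. 0 \<le> \<beta>' j"
      and j0: "j0 \<in> J" "\<beta>' j0 = 0"
    proof (cases "\<exists>j\<in>J. \<beta> j = 0")
      case True
      then show ?thesis using \<beta> that by auto
    next
      case False
      have le: "w \<bullet> s j \<le> 0" if "j \<in> J" for j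
        using ws[of "s j"] that by (simp add: C_def hull_inc)
      have "(\<Sum>j\<in>J. - (\<beta> j * (w \<bullet> s j))) = 0"
        using wz \<beta>(1) by (simp add: inner_sum_right sum_negf)
      then have "\<forall>j\<in>J. - (\<beta> j * (w \<bullet> s j)) = 0"
        using J(1) le \<beta>(2) by (subst (asm) sum_nonneg_eq_0_iff) (auto intro: mult_nonneg_nonpos)
      with False have ws0: "w \<bullet> s j = 0" if "j \<in> J" for j using that by auto
      \<comment> \<open>Forgetting a coordinate in which \<open>w\<close> does not vanish is
        injective on the hyperplane orthogonal to \<open>w\<close>; this leaves \<open>d - 1\<close>
        equations for \<open>d\<close> vectors.\<close>
      obtain e0 where e0: "e0 \<in> Basis" "w \<bullet> e0 \<noteq> 0" using w by (auto simp: euclidean_eq_iff[of w 0])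
      have "card (Basis - {e0}) < card J" using e0 J(2) DIM_positive[where 'a='a] by simp
      then obtain \<gamma> where \<gamma>: "\<exists>j\<in>J. \<gamma> j \<noteq> 0"
        "\<forall>e\<in>Basis - {e0}. (\<Sum>j\<in>J. \<gamma> j * (s j \<bullet> e)) = 0"
        using underdetermined_system[of "Basis - {e0}" J "\<lambda>j e. s j \<bullet> e"] J(1) by auto
      define x where "x = (\<Sum>j\<in>J. \<gamma> j *\<^sub>R s j)"
      have xe: "x \<bullet> e = 0" if "e \<in> Basis" "e \<noteq> e0" for e
        using \<gamma>(2) that by (simp add: x_def inner_sum_left)
      have "0 = w \<bullet> x" using ws0 by (simp add: x_def inner_sum_right)
      also have "\<dots> = (\<Sum>e\<in>Basis. (w \<bullet> e) * (x \<bullet> e))" by (rule euclidean_inner)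
      also have "\<dots> = (\<Sum>e\<in>Basis. if e = e0 then (w \<bullet> e0) * (x \<bullet> e0) else 0)"
        using xe by (intro sum.cong) auto
      also have "\<dots> = (w \<bullet> e0) * (x \<bullet> e0)" using e0 by simp
      finally have x: "x = 0" using e0 xe by (auto simp: euclidean_eq_iff[of x 0])
      obtain \<gamma>' where \<gamma>': "\<exists>j\<in>J. 0 < \<gamma>' j" "(\<Sum>j\<in>J. \<gamma>' j *\<^sub>R s j) = 0"
      proof (cases "\<exists>j\<in>J. 0 < \<gamma> j")
        case True
        then show ?thesis using that x by (auto simp: x_def)
      next
        case False
        then have "\<exists>j\<in>J. 0 < - \<gamma> j" using \<gamma>(1)
          by (metis linorder_neqE_linordered_idom neg_0_less_iff_less)
        then show ?thesis using that[of "\<lambda>j. - \<gamma> j"] x by (auto simp: x_def sum_negf)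
      qed
      obtain t where t: "\<forall>j\<in>J. 0 \<le> \<beta> j - t * \<gamma>' j" "\<exists>j\<in>J. \<beta> j - t * \<gamma>' j = 0"
        using nonneg_weights_reduce[OF J(1) \<beta>(2) \<gamma>'(1)] by metis
      have "(\<Sum>j\<in>J. (\<beta> j - t * \<gamma>' j) *\<^sub>R s j) = z - t *\<^sub>R (\<Sum>j\<in>J. \<gamma>' j *\<^sub>R s j)"
        by (simp add: \<beta>(1) scaleR_diff_left sum_subtractf scaleR_sum_right)
      then show ?thesis using t that[of "\<lambda>j. \<beta> j - t * \<gamma>' j"] \<gamma>'(2) by auto
    qed
    have "\<exists>y\<in>S j0. 0 < w \<bullet> y"
    proof (rule ccontr)
      assume "\<not> ?thesis"
      then have "S j0 \<subseteq> {y. w \<bullet> y \<le> 0}" by auto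
      moreover have "convex_cone {y. w \<bullet> y \<le> 0}"
        by (auto simp: convex_cone_iff inner_add_right intro: mult_nonneg_nonpos)
      ultimately have "convex_cone hull (S j0) \<subseteq> {y. w \<bullet> y \<le> 0}" by (rule hull_minimal)
      then have "w \<bullet> a \<le> 0" using a[OF j0(1)] by auto
      moreover have "w \<bullet> a = w \<bullet> w" using wz by (simp add: w_def inner_diff_right)
      ultimately show False using w by (metis inner_gt_zero_iff leD)
    qed
    then obtain y where y: "y \<in> S j0" "0 < w \<bullet> y" by blast
    define s' where "s' = s(j0 := y)"
    have s': "s' \<in> E" using s(1) y(1) j0(1) by (auto simp: E_def s'_def PiE_def extensional_def)
    have "0 \<le> 2 * e * (- (w \<bullet> y)) + e\<^sup>2 * (y \<bullet> y)" if e: "0 < e" "e \<le> 1" for e :: real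
    proof -
      have zC: "z \<in> C s'"
        unfolding C_def convex_cone_hull_finite_image[OF J(1)] using \<beta>' j0
        by (auto intro!: exI[of _ \<beta>'] sum.cong simp: s'_def)
      have "s' j0 \<in> C s'" using j0(1) by (auto simp: C_def intro: hull_inc)
      then have "z + e *\<^sub>R y \<in> C s'" using zC e
        unfolding C_def by (auto intro!: convex_cone_hull_add convex_cone_hull_mul simp: s'_def)
      then have "dist a z \<le> dist a (z + e *\<^sub>R y)"
        using s(2)[OF s'] Z(2) by (fastforce simp: z_def)
      then have "norm w \<le> norm (w - e *\<^sub>R y)" by (simp add: dist_norm w_def diff_diff_eq)
      then have "w \<bullet> w \<le> (w - e *\<^sub>R y) \<bullet> (w - e *\<^sub>R y)" by (simp add: norm_le)
      then show ?thesis
        by (simp add: inner_diff_left inner_diff_right inner_commute power2_eq_square algebra_simps)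
    qed
    then have "0 \<le> - (w \<bullet> y)" by (rule nonneg_of_quadratic)
    then show False using y by simp
  qed
  then have "a \<in> C s" using Z(1)[of s] by (simp add: w_def z_def)
  then show ?thesis using s(1) unfolding C_def E_def by blast
qed

section \<open>Colourful Caratheodory with a prescribed base point\<close>

lemma finite_subset_convex_hull:
  assumes "finite V" "V \<subseteq> convex hull S"
  obtains F where "finite F" "F \<subseteq> S" "V \<subseteq> convex hull F"
proof -
  have "\<exists>F. finite F \<and> F \<subseteq> S \<and> v \<in> convex hull F" if "v \<in> V" for v
  proof -
    have "v \<in> convex hull S" using assms(2) that by auto
    then obtain F u where "finite F" "F \<subseteq> S" "\<forall>x\<in>F. 0 \<le> u x" "sum u F = 1" "(\<Sum>x\<in>F. u x *\<^sub>R x) = v"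
      unfolding convex_hull_explicit by auto
    then show ?thesis by (intro exI[of _ F]) (auto simp: convex_hull_finite)
  qed
  then obtain F where F: "\<And>v. v \<in> V \<Longrightarrow> finite (F v) \<and> F v \<subseteq> S \<and> v \<in> convex hull (F v)"
    by metis
  show thesis
  proof (rule that[of "\<Union>v\<in>V. F v"])
    show "V \<subseteq> convex hull (\<Union>v\<in>V. F v)"
      using F hull_mono[of "F _" "\<Union>v\<in>V. F v"] by blast
  qed (use F assms in auto)
qed

text \<open>For \<open>v\<close> in the interior of all hulls, \<open>v - s0\<close> lies in each cone over \<open>S j - v\<close> and the cone version
  applies. Boundary points follow because, for finite \<open>S j\<close>, the union of the
  hulls of all choices is closed.\<close>

theorem colourful_caratheodory_base:
  fixes S :: "'j \<Rightarrow> 'a::euclidean_space set"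
  assumes J: "finite J" "card J = DIM('a)"
    and K: "convex K" "interior K \<noteq> {}" and v: "v \<in> K"
    and S: "\<And>j. j \<in> J \<Longrightarrow> K \<subseteq> convex hull (S j)"
  shows "\<exists>s. (\<forall>j\<in>J. s j \<in> S j) \<and> v \<in> convex hull (insert s0 (s ` J))"
proof -
  obtain x0 where x0: "x0 \<in> interior K" using K(2) by auto
  \<comment> \<open>A small box in \<open>K\<close> together with \<open>v\<close> generates a
    polytope \<open>P\<close> with interior points. Its finitely many generators lie in hulls of
    finite sets \<open>F j\<close>, which makes \<open>X\<close> a finite union of compact
    hulls.\<close>
  obtain l u :: 'a where lu: "cbox l u \<subseteq> interior K" "x0 \<in> box l u" "\<forall>i\<in>Basis. l \<bullet> i < u \<bullet> i"
    by (rule open_contains_cbox[OF open_interior x0])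
  obtain W where W: "finite W" "cbox l u = convex hull W"
    using polytope_interval[of l u] by (auto simp: polytope_def)
  define V where "V = insert v W"
  have "W \<subseteq> K" using W(2) lu(1) interior_subset hull_subset[of W convex] by blast
  then have V: "finite V" "V \<subseteq> K" using W(1) v by (auto simp: V_def)
  define P where "P = convex hull V"
  have "interior P \<noteq> {}"
  proof -
    have "box l u \<subseteq> P" using W(2) hull_mono[of W V convex] box_subset_cbox[of l u]
      by (auto simp: P_def V_def)
    then have "box l u \<subseteq> interior P" by (intro interior_maximal open_box)
    then show ?thesis using lu(2) by auto
  qed
  have "\<exists>F. finite F \<and> F \<subseteq> S j \<and> P \<subseteq> convex hull F" if "j \<in> J" for j
  proof -
    have "V \<subseteq> convex hull (S j)" using V(2) S[OF that] by blast
    then obtain F where "finite F" "F \<subseteq> S j" "V \<subseteq> convex hull F"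
      using finite_subset_convex_hull[OF V(1)] by metis
    then show ?thesis unfolding P_def by (intro exI[of _ F] conjI hull_minimal convex_convex_hull)
  qed
  then obtain F where F: "\<And>j. j \<in> J \<Longrightarrow> finite (F j)" "\<And>j. j \<in> J \<Longrightarrow> F j \<subseteq> S j"
    "\<And>j. j \<in> J \<Longrightarrow> P \<subseteq> convex hull (F j)" by metis
  define X where "X = (\<Union>s\<in>PiE J F. convex hull (insert s0 (s ` J)))"
  have "closed X" unfolding X_def
    using J F(1) by (intro closed_UN finite_PiE)
      (auto intro!: compact_imp_closed finite_imp_compact_convex_hull)
  moreover have "interior P \<subseteq> X"
  proof
    fix x assume x: "x \<in> interior P"
    then obtain e where e: "0 < e" "cball x e \<subseteq> P" by (auto simp: mem_interior_cball)
    define a where "a = x - s0"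
    have "\<exists>s. (\<forall>j\<in>J. s j \<in> (\<lambda>y. y - x) ` F j) \<and> a \<in> convex_cone hull (s ` J)"
    proof (rule colourful_caratheodory_cone[OF J])
      fix j assume j: "j \<in> J"
      \<comment> \<open>Membership in the cone does not depend on the length of \<open>a\<close>, so
        \<open>a\<close> is shrunk until \<open>x + t a\<close> stays in the ball inside all
        hulls.\<close>
      define t where "t = e / (norm a + 1)"
      have t: "0 < t" "t * norm a \<le> e" using e(1)
        by (auto simp: t_def field_simps add_pos_nonneg)
      have "x + t *\<^sub>R a \<in> cball x e" using t by (simp add: dist_norm)
      then have "x + t *\<^sub>R a \<in> convex hull (F j)" using e(2) F(3)[OF j] by blast
      then have "t *\<^sub>R a \<in> (\<lambda>y. - x + y) ` (convex hull (F j))" by force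
      then have "t *\<^sub>R a \<in> convex hull ((\<lambda>y. y - x) ` F j)"
        using convex_hull_translation[of "- x" "F j"] by simp
      then have "t *\<^sub>R a \<in> convex_cone hull ((\<lambda>y. y - x) ` F j)"
        using convex_hull_subset_convex_cone_hull by blast
      from convex_cone_hull_mul[OF this, of "inverse t"]
      show "a \<in> convex_cone hull ((\<lambda>y. y - x) ` F j)" using t by simp
      have "x \<in> cball x e" using e(1) by simp
      then have "x \<in> convex hull (F j)" using e(2) F(3)[OF j] by blast
      then show "(\<lambda>y. y - x) ` F j \<noteq> {}" by auto
    qed (use F in auto)
    then obtain s' where s': "\<forall>j\<in>J. s' j \<in> (\<lambda>y. y - x) ` F j" "a \<in> convex_cone hull (s' ` J)"
      by blast
    define s where "s = restrict (\<lambda>j. s' j + x) J"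
    have s: "s \<in> PiE J F" using s'(1) by (auto simp: s_def)
    obtain \<beta> where \<beta>: "a = (\<Sum>j\<in>J. \<beta> j *\<^sub>R s' j)" "\<forall>j\<in>J. 0 \<le> \<beta> j"
      using s'(2) unfolding convex_cone_hull_finite_image[OF J(1)] by blast
    \<comment> \<open>Undoing the shift by \<open>x\<close> gives \<open>T x\<close> as
      \<open>s0\<close> plus the cone combination; division by \<open>T\<close>, the total weight,
      makes it convex.\<close>
    define T where "T = 1 + sum \<beta> J"
    have T: "0 < T" using \<beta>(2) by (simp add: T_def add_pos_nonneg sum_nonneg)
    have "a = (\<Sum>j\<in>J. \<beta> j *\<^sub>R s j) - sum \<beta> J *\<^sub>R x"
      by (simp add: \<beta>(1) s_def sum.distrib scaleR_add_right scaleR_sum_left)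
    then have Tx: "T *\<^sub>R x = s0 + (\<Sum>j\<in>J. \<beta> j *\<^sub>R s j)"
      by (simp add: T_def a_def scaleR_add_left algebra_simps)
    have "x = inverse T *\<^sub>R T *\<^sub>R x" using T by simp
    also have "\<dots> = (1 / T) *\<^sub>R s0 + (\<Sum>j\<in>J. (\<beta> j / T) *\<^sub>R s j)"
      unfolding Tx by (simp add: scaleR_add_right scaleR_sum_right divide_inverse mult.commute)
    \<comment> \<open>The index \<open>None\<close> adjoins the base point as a separate summand,
      even if it coincides with some \<open>s j\<close>.\<close>
    also have "\<dots> = (\<Sum>i\<in>insert None (Some ` J).
        (case i of None \<Rightarrow> 1 / T | Some j \<Rightarrow> \<beta> j / T) *\<^sub>R (case i of None \<Rightarrow> s0 | Some j \<Rightarrow> s j))"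
      using J(1) by (subst sum.insert) (auto simp: sum.reindex)
    also have "\<dots> \<in> convex hull (insert s0 (s ` J))"
    proof (rule convex_sum)
      have "1 / T + (\<Sum>j\<in>J. \<beta> j / T) = T / T"
        by (simp only: T_def sum_divide_distrib add_divide_distrib)
      then show "(\<Sum>i\<in>insert None (Some ` J). case i of None \<Rightarrow> 1 / T | Some j \<Rightarrow> \<beta> j / T) = 1"
        using J(1) T by (subst sum.insert) (auto simp: sum.reindex)
    qed (use J(1) T \<beta>(2) in \<open>auto intro!: hull_inc\<close>)
    finally show "x \<in> X" using s by (auto simp: X_def)
  qed
  ultimately have "closure (interior P) \<subseteq> X" by (rule closure_minimal[rotated])
  moreover have "v \<in> closure (interior P)"
    using convex_closure_interior[OF _ \<open>interior P \<noteq> {}\<close>] closure_subset[of P]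
    by (auto simp: P_def V_def intro: hull_inc)
  ultimately obtain s where "s \<in> PiE J F" "v \<in> convex hull (insert s0 (s ` J))"
    by (auto simp: X_def)
  then show ?thesis using F(2) by (intro exI[of _ s]) auto
qed

section \<open>Enclosing a ball by colourful choices\<close>

text \<open>Bang's sign choice for the plank problem: take the signed sum of maximal norm. Flipping
  the sign of \<open>k\<close> changes the squared norm by 4 \<open>w\<close> (w - \<epsilon> k (A
  \<bullet> u k)), which cannot be positive.\<close>

lemma bang_signs:
  fixes u :: "'k \<Rightarrow> 'a::real_inner" and w :: real
  assumes N: "finite N" and u: "\<And>k. k \<in> N \<Longrightarrow> norm (u k) = 1" and w: "0 < w"
  obtains a where "norm a \<le> card N * w" "\<And>k. k \<in> N \<Longrightarrow> w \<le> \<bar>a \<bullet> u k\<bar>"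
proof -
  define E where "E = PiE N (\<lambda>_. {- 1, 1 :: real})"
  define A where "A \<epsilon> = (\<Sum>k\<in>N. (\<epsilon> k * w) *\<^sub>R u k)" for \<epsilon> :: "'k \<Rightarrow> real"
  have E: "finite E" "E \<noteq> {}" using N by (auto simp: E_def finite_PiE PiE_eq_empty_iff)
  obtain \<epsilon> where \<epsilon>: "\<epsilon> \<in> E" "\<And>\<epsilon>'. \<epsilon>' \<in> E \<Longrightarrow> - norm (A \<epsilon>) \<le> - norm (A \<epsilon>')"
    using ex_is_arg_min_if_finite[OF E, of "\<lambda>\<epsilon>. - norm (A \<epsilon>)"]
    by (auto simp: is_arg_min_linorder)
  have sgn: "\<epsilon> k = - 1 \<or> \<epsilon> k = 1" if "k \<in> N" for k
    using \<epsilon>(1) that by (auto simp: E_def)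
  show thesis
  proof (rule that[of "A \<epsilon>"])
    have "norm (A \<epsilon>) \<le> (\<Sum>k\<in>N. w)"
      unfolding A_def using u sgn w by (intro sum_norm_le) (force simp: abs_mult)
    then show "norm (A \<epsilon>) \<le> card N * w" by simp
    fix k assume k: "k \<in> N"
    define \<epsilon>' where "\<epsilon>' = \<epsilon>(k := - \<epsilon> k)"
    have "\<epsilon>' \<in> E" using \<epsilon>(1) k sgn[OF k]
      by (auto simp: E_def \<epsilon>'_def PiE_iff extensional_def)
    then have "norm (A \<epsilon>') \<le> norm (A \<epsilon>)" using \<epsilon>(2) by (simp only: neg_le_iff_le)
    moreover have "A \<epsilon>' = A \<epsilon> - (2 * \<epsilon> k * w) *\<^sub>R u k"
    proof -
      have "\<epsilon>' i * w = \<epsilon> i * w - (if i = k then 2 * \<epsilon> k * w else 0)" for i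
        by (simp add: \<epsilon>'_def)
      then have "A \<epsilon>' = (\<Sum>i\<in>N. (\<epsilon> i * w) *\<^sub>R u i - (if i = k then (2 * \<epsilon> k * w) *\<^sub>R u k else 0))"
        unfolding A_def by (intro sum.cong refl) (simp add: scaleR_diff_left)
      also have "\<dots> = A \<epsilon> - (2 * \<epsilon> k * w) *\<^sub>R u k"
        unfolding A_def sum_subtractf using N k by simp
      finally show ?thesis .
    qed
    ultimately have "(A \<epsilon> - (2 * \<epsilon> k * w) *\<^sub>R u k) \<bullet> (A \<epsilon> - (2 * \<epsilon> k * w) *\<^sub>R u k) \<le> A \<epsilon> \<bullet> A \<epsilon>"
      by (simp add: norm_le)
    moreover have "u k \<bullet> u k = 1" using u[OF k] by (simp add: norm_eq_1)
    moreover have "\<epsilon> k * \<epsilon> k = 1" using sgn[OF k] by auto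
    ultimately have "4 * w * w \<le> 4 * w * (\<epsilon> k * (A \<epsilon> \<bullet> u k))"
      by (simp add: inner_diff_left inner_diff_right inner_commute algebra_simps)
    then have "w \<le> \<epsilon> k * (A \<epsilon> \<bullet> u k)" using w by simp
    then show "w \<le> \<bar>A \<epsilon> \<bullet> u k\<bar>" using sgn[OF k] by auto
  qed
qed

lemma convex_sum_subprob:
  fixes y :: "'i \<Rightarrow> 'a::real_vector"
  assumes "finite I" "convex C" "0 \<in> C" "\<And>i. i \<in> I \<Longrightarrow> 0 \<le> c i" "sum c I \<le> 1"
    "\<And>i. i \<in> I \<Longrightarrow> y i \<in> C"
  shows "(\<Sum>i\<in>I. c i *\<^sub>R y i) \<in> C"
proof -
  have "(\<Sum>i\<in>I. c i *\<^sub>R y i) = (\<Sum>i\<in>insert None (Some ` I).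
      (case i of None \<Rightarrow> 1 - sum c I | Some i \<Rightarrow> c i) *\<^sub>R (case i of None \<Rightarrow> 0 | Some i \<Rightarrow> y i))"
    using assms(1) by (subst sum.insert) (auto simp: sum.reindex)
  also have "\<dots> \<in> C"
    using assms by (intro convex_sum) (auto simp: sum.insert sum.reindex)
  finally show ?thesis .
qed

text \<open>Every point of \<open>W\<close> consumes its own block of \<open>d\<close> colours,
  while the base point \<open>s0\<close> is shared by all blocks. Surplus colours are chosen
  arbitrarily in the base case.\<close>

lemma colourful_hull_contains_finite:
  fixes S :: "'j \<Rightarrow> 'a::euclidean_space set"
  assumes "finite W" "W \<subseteq> K" "convex K" "interior K \<noteq> {}"
    and "finite J" "card W * DIM('a) \<le> card J" "\<And>j. j \<in> J \<Longrightarrow> K \<subseteq> convex hull (S j)"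
  shows "\<exists>s. (\<forall>j\<in>J. s j \<in> S j) \<and> W \<subseteq> convex hull (insert s0 (s ` J))"
  using assms
proof (induction W arbitrary: J rule: finite_induct)
  case empty
  have "S j \<noteq> {}" if "j \<in> J" for j
    using empty.prems(3,6) that interior_subset[of K] by fastforce
  then have "\<exists>s. \<forall>j\<in>J. s j \<in> S j" by (intro bchoice) auto
  then show ?case by auto
next
  case (insert v W)
  obtain J' where J': "J' \<subseteq> J" "card J' = DIM('a)"
    using insert.prems(5) insert.hyps obtain_subset_with_card_n[of "DIM('a)" J] by auto
  then have fin: "finite J'" using insert.prems(4) finite_subset by blast
  obtain s1 where s1: "\<forall>j\<in>J'. s1 j \<in> S j" "v \<in> convex hull (insert s0 (s1 ` J'))"
    using colourful_caratheodory_base[OF fin J'(2), of K v S s0] insert.prems J'(1) by blast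
  have "card W * DIM('a) \<le> card (J - J')"
    using insert.prems(4,5) insert.hyps J' fin by (simp add: card_Diff_subset)
  then obtain s2 where s2: "\<forall>j\<in>J - J'. s2 j \<in> S j" "W \<subseteq> convex hull (insert s0 (s2 ` (J - J')))"
    using insert.IH[of "J - J'"] insert.prems by auto
  define s where "s j = (if j \<in> J' then s1 j else s2 j)" for j
  have "convex hull (insert s0 (s1 ` J')) \<subseteq> convex hull (insert s0 (s ` J))"
    "convex hull (insert s0 (s2 ` (J - J'))) \<subseteq> convex hull (insert s0 (s ` J))"
    using J'(1) by (auto intro!: hull_mono simp: s_def)
  then show ?case using s1 s2 by (intro exI[of _ s]) (auto simp: s_def)
qed

text \<open>The ball is invariant under rotations, so \<open>V\<close> may be rotated until one of its points \<open>v1\<close> is on the ray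
  through a point \<open>s0\<close> outside the open unit ball. Then \<open>v1\<close> is covered by \<open>s0\<close> and the other points of \<open>V\<close>,
  which is why only \<open>card V - 1\<close> blocks of \<open>d\<close> colours are used, all with the base point \<open>s0\<close>.\<close>

theorem colourful_hull_contains_ball:
  fixes S :: "'j \<Rightarrow> (real ^ 'd) set"
  assumes V: "finite V" "V \<subseteq> cball (0 :: real ^ 'd) 1" "cball 0 \<rho> \<subseteq> convex hull V" and \<rho>: "0 < \<rho>"
    and J: "finite J" "(card V - 1) * CARD('d) < card J"
    and S: "\<And>j. j \<in> J \<Longrightarrow> cball 0 1 \<subseteq> convex hull (S j)"
  shows "\<exists>s. (\<forall>j\<in>J. s j \<in> S j) \<and> cball 0 \<rho> \<subseteq> convex hull (s ` J)"
proof -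
  obtain j0 where j0: "j0 \<in> J" using J(2) by fastforce
  obtain e :: "real ^ 'd" where e: "norm e = 1" by (metis norm_axis_1)
  \<comment> \<open>A set inside the open unit ball, which is convex, could not have the closed ball
    in its hull.\<close>
  obtain s0 where s0: "s0 \<in> S j0" "1 \<le> norm s0"
  proof (rule ccontr)
    assume "\<not> thesis"
    then have "S j0 \<subseteq> ball 0 1" using that by fastforce
    then have "convex hull (S j0) \<subseteq> ball 0 1" by (simp add: hull_minimal)
    moreover have "e \<in> convex hull (S j0)" using S[OF j0] e by auto
    ultimately show False using e by auto
  qed
  have hull0: "0 \<in> convex hull V" using V(3) \<rho> by auto
  obtain v1 where v1: "v1 \<in> V" "v1 \<noteq> 0"
  proof (rule ccontr)
    assume "\<not> thesis"
    then have "convex hull V \<subseteq> {0}" using that by (intro hull_minimal) auto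
    moreover have "\<rho> *\<^sub>R e \<in> convex hull V" using V(3) e \<rho> by auto
    ultimately have "\<rho> *\<^sub>R e = 0" by blast
    then show False using e \<rho> by auto
  qed
  define c where "c = norm s0 / norm v1"
  have c: "1 \<le> c" using v1 s0 V(2) by (auto simp: c_def pos_le_divide_eq)
  obtain f :: "real ^ 'd \<Rightarrow> real ^ 'd" where f: "orthogonal_transformation f" "f v1 = inverse c *\<^sub>R s0"
    by (rule orthogonal_transformation_exists[of v1 "inverse c *\<^sub>R s0"])
       (use s0 v1 in \<open>auto simp: c_def\<close>)
  have lin: "linear f" using f(1) by (simp add: orthogonal_transformation_linear)
  have s0f: "s0 = c *\<^sub>R f v1" using c f(2) by simp
  define V' where "V' = V - {v1}"
  have V': "V = insert v1 V'" "finite V'" "V' \<subseteq> cball 0 1" "card (f ` V') \<le> card V - 1"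
    using v1 V card_image_le[of V' f] by (auto simp: V'_def)
  have J0: "finite (J - {j0})" "card (f ` V') * DIM(real ^ 'd) \<le> card (J - {j0})"
  proof -
    have "card (f ` V') * CARD('d) \<le> (card V - 1) * CARD('d)" using V'(4) by (rule mult_le_mono1)
    moreover have "card (J - {j0}) = card J - 1" using J j0 by simp
    ultimately show "card (f ` V') * DIM(real ^ 'd) \<le> card (J - {j0})"
      using J(2) unfolding DIM_cart DIM_real mult_1_right by linarith
  qed (use J in auto)
  have "\<exists>s. (\<forall>j\<in>J - {j0}. s j \<in> S j) \<and> f ` V' \<subseteq> convex hull (insert s0 (s ` (J - {j0})))"
    by (rule colourful_hull_contains_finite[of "f ` V'" "cball 0 1"])
       (use V' J0 S f(1) in \<open>auto simp: orthogonal_transformation_norm\<close>)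
  then obtain s where s: "\<forall>j\<in>J - {j0}. s j \<in> S j"
    "f ` V' \<subseteq> convex hull (insert s0 (s ` (J - {j0})))" by blast
  define s' where "s' = s(j0 := s0)"
  define C where "C = convex hull (s' ` J)"
  have img: "s' ` J = insert s0 (s ` (J - {j0}))" using j0 by (auto simp: s'_def)
  have C: "convex C" "s0 \<in> C" "f ` V' \<subseteq> C" using s(2) by (auto simp: C_def img intro: hull_inc)
  \<comment> \<open>Since 0 is in the hull of \<open>V\<close>, the hull of the other points
    contains some \<open>y = - h v1\<close> with \<open>h \<ge> 0\<close>.\<close>
  have "V' \<noteq> {}" using hull0 v1 V'(1) by auto
  then obtain u t y where ut: "0 \<le> u" "0 \<le> t" "u + t = 1" and y: "y \<in> convex hull V'"
    and 0: "0 = u *\<^sub>R v1 + t *\<^sub>R y"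
    using hull0 unfolding V'(1) convex_hull_insert[OF \<open>V' \<noteq> {}\<close>] by auto
  have t: "0 < t" using ut 0 v1(2) by (cases "t = 0") auto
  define h where "h = u / t"
  have h: "0 \<le> h" using ut t by (simp add: h_def)
  have fy: "f y = - (h *\<^sub>R f v1)"
  proof -
    have "t *\<^sub>R y = - (u *\<^sub>R v1)" using 0 by (simp add: eq_neg_iff_add_eq_0 add.commute)
    then have "inverse t *\<^sub>R t *\<^sub>R y = inverse t *\<^sub>R - (u *\<^sub>R v1)" by simp
    then have "y = - (h *\<^sub>R v1)" using t by (simp add: h_def divide_inverse mult.commute)
    then show ?thesis using lin by (simp add: linear_neg linear_cmul)
  qed
  have "f y \<in> f ` (convex hull V')" using y by blast
  also have "\<dots> = convex hull (f ` V')" using lin by (rule convex_hull_linear_image)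
  also have "\<dots> \<subseteq> C" using C by (intro hull_minimal)
  finally have fyC: "f y \<in> C" .
  \<comment> \<open>On the line spanned by \<open>f v1\<close> the points \<open>f y\<close> and
    \<open>s0\<close> have coordinates \<open>- h\<close> and \<open>c\<close>;
    \<open>\<alpha>\<close> places coordinate 1 on the segment between them.\<close>
  define \<alpha> where "\<alpha> = (1 + h) / (c + h)"
  have \<alpha>: "0 \<le> \<alpha>" "\<alpha> \<le> 1" "\<alpha> * c - (1 - \<alpha>) * h = 1"
    using c h by (auto simp: \<alpha>_def divide_simps) (simp add: algebra_simps)
  have "f v1 = (\<alpha> * c - (1 - \<alpha>) * h) *\<^sub>R f v1" using \<alpha>(3) by simp
  also have "\<dots> = \<alpha> *\<^sub>R s0 + (1 - \<alpha>) *\<^sub>R f y"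
    unfolding s0f fy by (simp add: scaleR_diff_left)
  also have "\<dots> \<in> C" using C(1,2) fyC \<alpha> by (intro convexD) auto
  finally have "f ` V \<subseteq> C" using C(3) V'(1) by auto
  then have "convex hull (f ` V) \<subseteq> C" using C(1) by (intro hull_minimal)
  then have fhull: "f ` (convex hull V) \<subseteq> C" using lin by (simp add: convex_hull_linear_image)
  have "cball 0 \<rho> \<subseteq> C"
  proof
    fix x :: "real ^ 'd" assume x: "x \<in> cball 0 \<rho>"
    obtain x' where x': "x = f x'" using orthogonal_transformation_surj[OF f(1)] by (metis surjD)
    then have "x' \<in> cball 0 \<rho>" using x f(1) by (simp add: orthogonal_transformation_norm)
    then show "x \<in> C" using V(3) fhull x' by blast
  qed
  moreover have "\<forall>j\<in>J. s' j \<in> S j" using s(1) s0 by (auto simp: s'_def)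
  ultimately show ?thesis unfolding C_def by blast
qed

text \<open>The simplex has the basis vectors and the unit vector opposite to their sum as vertices.
  It is not regular in general, but its barycentric coordinates are explicit, at the price of a
  factor 2 against the inradius 1 / d of the regular one.\<close>

lemma simplex_contains_ball:
  fixes d :: real
  defines "d \<equiv> CARD('d::finite)"
  obtains V :: "(real ^ 'd) set" where "finite V" "card V \<le> CARD('d) + 1" "V \<subseteq> cball 0 1"
    "cball 0 (1 / (2 * d)) \<subseteq> convex hull V"
proof -
  define one :: "real ^ 'd" where "one = (\<chi> i. 1)"
  define q where "q = - ((1 / sqrt d) *\<^sub>R one)"
  define V where "V = insert q (range (\<lambda>i. axis i 1))"
  have d: "1 \<le> d" using one_le_card_finite[where 'a='d] by (simp add: d_def)
  have one: "one \<bullet> one = d" by (simp add: one_def inner_vec_def d_def)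
  have "norm one = sqrt d" by (simp add: norm_eq_sqrt_inner one)
  then have "norm q = 1" using d by (simp add: q_def)
  then have "V \<subseteq> cball 0 1" by (auto simp: V_def norm_axis_1)
  moreover have "card V \<le> CARD('d) + 1"
  proof -
    have "card V \<le> card (range (\<lambda>i::'d. axis i (1::real))) + 1"
      by (simp add: V_def card_insert_if)
    then show ?thesis using card_image_le[of "UNIV::'d set" "\<lambda>i. axis i (1::real)"] by simp
  qed
  moreover have "cball 0 (1 / (2 * d)) \<subseteq> convex hull V"
  proof
    fix x :: "real ^ 'd" assume "x \<in> cball 0 (1 / (2 * d))"
    then have x: "norm x \<le> 1 / (2 * d)" by simp
    define D where "D = d + sqrt d"
    have "sqrt d \<le> d" using d real_sqrt_le_mono[of d "d * d"] mult_left_mono[of 1 d d] by simp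
    moreover have "0 \<le> sqrt d" using d by simp
    ultimately have D: "0 < D" "d \<le> D" "D \<le> 2 * d" using d unfolding D_def by linarith+
    define s where "s = one \<bullet> x"
    \<comment> \<open>The weight of \<open>q\<close>, found from the condition that the weights
      \<theta> and \<open>x $ i + \<theta> / sqrt d\<close> sum to 1.\<close>
    define \<theta> where "\<theta> = (1 - s) / (1 + sqrt d)"
    have \<theta>D: "\<theta> / sqrt d = (1 - s) / D"
      using d by (simp add: \<theta>_def D_def algebra_simps)
    have s_sum: "s = (\<Sum>i\<in>UNIV. x $ i)" by (simp add: s_def one_def inner_vec_def)
    have coef: "0 \<le> x $ k + (1 - s) / D" for k
    proof -
      \<comment> \<open>The coefficient to be bounded is \<open>1 / D - x \<bullet> y\<close>, and
        \<open>y\<close> has norm at most 1.\<close>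
      define y where "y = (1 / D) *\<^sub>R one - axis k 1"
      have "(norm y)\<^sup>2 = d / D / D - 2 / D + 1"
        using one by (simp add: y_def power2_norm_eq_inner inner_diff_left inner_diff_right
            inner_axis inner_axis' one_def diff_divide_distrib)
      also have "\<dots> \<le> 1" using D by (simp add: divide_simps)
      finally have "norm y \<le> 1" by (simp add: power_le_one_iff abs_square_le_1)
      have "x \<bullet> y \<le> norm x * norm y" by (rule norm_cauchy_schwarz)
      also have "\<dots> \<le> 1 / (2 * d) * 1"
        using x \<open>norm y \<le> 1\<close> d by (intro mult_mono) auto
      also have "\<dots> \<le> 1 / D" using D d by (simp add: frac_le)
      finally have "x \<bullet> y \<le> 1 / D" .
      moreover have "x \<bullet> y = s / D - x $ k"
        by (simp add: y_def inner_diff_right inner_axis s_def inner_commute)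
      ultimately show ?thesis by (simp add: diff_divide_distrib)
    qed
    have \<theta>: "0 \<le> \<theta>"
    proof -
      have "s \<le> norm one * norm x" unfolding s_def by (rule norm_cauchy_schwarz)
      also have "\<dots> \<le> sqrt d * (1 / (2 * d))" using x \<open>norm one = sqrt d\<close> d
        by (intro mult_mono) auto
      also have "\<dots> \<le> d * (1 / (2 * d))"
        using d real_sqrt_le_mono[of d "d * d"] mult_left_mono[of 1 d d]
        by (intro mult_right_mono) auto
      also have "\<dots> \<le> 1" using d by simp
      finally show ?thesis using d by (simp add: \<theta>_def)
    qed
    have sum1: "\<theta> + (\<Sum>i\<in>(UNIV::'d set). x $ i + (1 - s) / D) = 1"
    proof -
      have "d * ((1 - s) / D) = sqrt d * \<theta>"
        unfolding \<theta>D[symmetric] using d by (simp add: field_simps)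
      moreover have "\<theta> * (1 + sqrt d) = 1 - s" using d by (simp add: \<theta>_def add_nonneg_eq_0_iff)
      ultimately show ?thesis
        by (simp add: sum.distrib s_sum[symmetric] d_def[symmetric] algebra_simps)
    qed
    have "x = \<theta> *\<^sub>R q + (\<Sum>i\<in>UNIV. (x $ i + (1 - s) / D) *\<^sub>R axis i 1)"
      by (simp add: vec_eq_iff q_def one_def axis_def \<theta>D[symmetric] if_distrib[of "\<lambda>y. _ * y"] cong: if_cong)
    also have "\<dots> = (\<Sum>i\<in>insert None (range Some).
        (case i of None \<Rightarrow> \<theta> | Some i \<Rightarrow> x $ i + (1 - s) / D)
          *\<^sub>R (case i of None \<Rightarrow> q | Some i \<Rightarrow> axis i 1))"
      by (subst sum.insert) (auto simp: sum.reindex)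
    also have "\<dots> \<in> convex hull V"
      using sum1 \<theta> coef by (intro convex_sum) (auto simp: sum.reindex V_def intro!: hull_inc)
    finally show "x \<in> convex hull V" .
  qed
  ultimately show thesis using that[of V] by (simp add: V_def)
qed

text \<open>All colours equal \<open>S\<close>. One of the \<open>d + 1\<close> simplex vertices
  costs a single point and the others \<open>d\<close> points each. The size of \<open>F\<close>
  enters the final radius through the number of hyperplanes.\<close>

lemma few_points_hull_contains_ball:
  fixes S :: "(real ^ 'd) set"
  assumes "cball 0 1 \<subseteq> convex hull S"
  obtains F where "finite F" "F \<subseteq> S" "card F \<le> CARD('d) * CARD('d) + 1"
    "cball 0 (1 / (2 * real CARD('d))) \<subseteq> convex hull F"
proof -
  let ?d = "CARD('d)"
  obtain V :: "(real ^ 'd) set" where V: "finite V" "card V \<le> ?d + 1" "V \<subseteq> cball 0 1"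
    "cball 0 (1 / (2 * real ?d)) \<subseteq> convex hull V" by (rule simplex_contains_ball)
  have "(card V - 1) * ?d < card {..< ?d * ?d + 1}"
    using V(2) by (simp add: le_imp_less_Suc mult_le_mono1)
  then obtain s where s: "\<forall>j\<in>{..< ?d * ?d + 1}. s j \<in> S"
    "cball 0 (1 / (2 * real ?d)) \<subseteq> convex hull (s ` {..< ?d * ?d + 1})"
    using colourful_hull_contains_ball[OF V(1,3,4), of "{..< ?d * ?d + 1}" "\<lambda>_. S"] assms by auto
  show thesis
    by (rule that[of "s ` {..< ?d * ?d + 1}"])
       (use s card_image_le[of "{..< ?d * ?d + 1}" s] in auto)
qed

section \<open>A quantitative Steinitz theorem with two blocks of \<open>d\<close> colours\<close>

lemma biorthogonal_expansion:
  fixes s \<sigma> :: "'j \<Rightarrow> 'a::euclidean_space"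
  assumes J: "finite J" "card J = DIM('a)"
    and bi: "\<And>i j. i \<in> J \<Longrightarrow> j \<in> J \<Longrightarrow> \<sigma> i \<bullet> s j = (if i = j then 1 else 0)"
  shows "x = (\<Sum>j\<in>J. (\<sigma> j \<bullet> x) *\<^sub>R s j)"
proof -
  define b where "b i = (case i of None \<Rightarrow> x | Some j \<Rightarrow> s j)" for i
  obtain \<gamma> where \<gamma>: "\<exists>i\<in>insert None (Some ` J). \<gamma> i \<noteq> 0"
    "\<forall>e\<in>Basis. (\<Sum>i\<in>insert None (Some ` J). \<gamma> i * (b i \<bullet> e)) = 0"
    using underdetermined_system[of "Basis :: 'a set" "insert None (Some ` J)" "\<lambda>i e. b i \<bullet> e"] J
    by (auto simp: card_image)
  have "(\<Sum>i\<in>insert None (Some ` J). \<gamma> i *\<^sub>R b i) = 0"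
  proof (rule euclidean_eqI)
    fix e :: 'a assume "e \<in> Basis"
    then show "(\<Sum>i\<in>insert None (Some ` J). \<gamma> i *\<^sub>R b i) \<bullet> e = 0 \<bullet> e"
      using \<gamma>(2) by (simp only: inner_sum_left inner_scaleR_left inner_zero_left)
  qed
  then have dep: "\<gamma> None *\<^sub>R x + (\<Sum>j\<in>J. \<gamma> (Some j) *\<^sub>R s j) = 0"
    using J(1) by (simp add: b_def sum.reindex)
  \<comment> \<open>Pairing the relation among \<open>x\<close> and the \<open>s j\<close> with the
    dual vectors ties all coefficients to that of \<open>x\<close>, which therefore cannot
    vanish.\<close>
  have coef: "\<gamma> (Some i) = - (\<gamma> None * (\<sigma> i \<bullet> x))" if i: "i \<in> J" for i
  proof -
    have "0 = \<sigma> i \<bullet> (\<gamma> None *\<^sub>R x + (\<Sum>j\<in>J. \<gamma> (Some j) *\<^sub>R s j))" using dep by simp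
    also have "\<dots> = \<gamma> None * (\<sigma> i \<bullet> x) + (\<Sum>j\<in>J. if i = j then \<gamma> (Some j) else 0)"
      using bi[OF i] by (auto simp: inner_add_right inner_sum_right intro!: sum.cong)
    also have "\<dots> = \<gamma> None * (\<sigma> i \<bullet> x) + \<gamma> (Some i)" using J(1) i by simp
    finally show ?thesis by simp
  qed
  have \<gamma>0: "\<gamma> None \<noteq> 0" using \<gamma>(1) coef by auto
  have "\<gamma> None *\<^sub>R (x - (\<Sum>j\<in>J. (\<sigma> j \<bullet> x) *\<^sub>R s j)) = 0"
  proof -
    have "(\<Sum>j\<in>J. \<gamma> (Some j) *\<^sub>R s j) = - (\<gamma> None *\<^sub>R (\<Sum>j\<in>J. (\<sigma> j \<bullet> x) *\<^sub>R s j))"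
      unfolding scaleR_sum_right sum_negf[symmetric] by (intro sum.cong) (auto simp: coef)
    then show ?thesis using dep by (simp add: scaleR_diff_right)
  qed
  then show ?thesis using \<gamma>0 by simp
qed

lemma ex_unit_orthogonal:
  fixes A :: "'a::euclidean_space set"
  assumes "finite A" "card A < DIM('a)"
  shows "\<exists>u. norm u = 1 \<and> (\<forall>x\<in>A. u \<bullet> x = 0)"
proof -
  have "dim A < DIM('a)" using dim_le_card'[OF assms(1)] assms(2) by simp
  then obtain y where y: "y \<noteq> 0" "\<And>x. x \<in> span A \<Longrightarrow> orthogonal y x"
    using orthogonal_to_subspace_exists[of A] by metis
  then show ?thesis
    by (intro exI[of _ "y /\<^sub>R norm y"]) (auto simp: orthogonal_def span_base)
qed

text \<open>Bang's lemma gives a point \<open>a\<close> of the ball of radius \<open>\<rho>\<close> at distance at least \<open>w\<close> from each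
  hyperplane through 0 and \<open>d - 1\<close> points of different colours. Hence, if \<open>a\<close> is in the hull of 0 and a choice
  from the first \<open>d\<close> colours, it is \<open>w\<close>-deep in the cone over that choice. The other \<open>d\<close> colours,
  with a base point among the first, are used to reach \<open>- a / norm a\<close>.\<close>

lemma colourful_steinitz_few_points:
  fixes S :: "'j \<Rightarrow> 'a::euclidean_space set" and f :: nat
  defines "d \<equiv> DIM('a)"
  assumes J: "finite J" "card J = 2 * d"
    and S: "\<And>j. j \<in> J \<Longrightarrow> cball 0 1 \<subseteq> convex hull (S j)"
    and \<rho>: "0 < \<rho>"
    and few: "\<And>j. j \<in> J \<Longrightarrow> \<exists>F. finite F \<and> F \<subseteq> S j \<and> card F \<le> f \<and> cball 0 \<rho> \<subseteq> convex hull F"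
  shows "\<exists>s. (\<forall>j\<in>J. s j \<in> S j) \<and>
    cball 0 (\<rho> / (d * f ^ (d - 1)) / (2 + \<rho>)) \<subseteq> convex hull (s ` J)"
proof -
  have d: "0 < d" by (simp add: d_def)
  obtain J1 where J1: "J1 \<subseteq> J" "card J1 = d" using J obtain_subset_with_card_n[of d J] by auto
  define J2 where "J2 = J - J1"
  have fin: "finite J1" "finite J2" using J1 J(1) finite_subset by (auto simp: J2_def)
  have J2: "card J2 = d" using J J1 fin(1) by (simp add: J2_def card_Diff_subset)
  obtain F where F: "\<And>j. j \<in> J \<Longrightarrow> finite (F j)" "\<And>j. j \<in> J \<Longrightarrow> F j \<subseteq> S j"
    "\<And>j. j \<in> J \<Longrightarrow> card (F j) \<le> f" "\<And>j. j \<in> J \<Longrightarrow> cball 0 \<rho> \<subseteq> convex hull (F j)"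
    using few by metis
  obtain j1 where j1: "j1 \<in> J1" using J1 d by fastforce
  have f0: "0 < f"
  proof (rule ccontr)
    assume "\<not> 0 < f"
    then have "F j1 = {}" using F(1,3)[of j1] j1 J1 by auto
    then show False using F(4)[of j1] j1 J1(1) \<rho> by auto
  qed
  \<comment> \<open>The largest depth for which Bang's norm bound, the number of hyperplanes times
    \<open>w\<close>, is guaranteed not to exceed \<rho>.\<close>
  define w where "w = \<rho> / (d * f ^ (d - 1))"
  have w: "0 < w" using \<rho> d f0 by (simp add: w_def)
  define N where "N = (SIGMA j:J1. PiE (J1 - {j}) F)"
  have finN: "finite N" unfolding N_def using fin F(1) J1(1) by (intro finite_SigmaI finite_PiE) auto
  have cardN: "card N \<le> d * f ^ (d - 1)"
  proof -
    have "card N = (\<Sum>j\<in>J1. card (PiE (J1 - {j}) F))" unfolding N_def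
      using fin F(1) J1(1) by (intro card_SigmaI ballI finite_PiE) auto
    also have "\<dots> \<le> (\<Sum>j\<in>J1. f ^ (d - 1))"
    proof (rule sum_mono)
      fix j assume j: "j \<in> J1"
      have "card (PiE (J1 - {j}) F) = (\<Prod>i\<in>J1 - {j}. card (F i))" using fin by (simp add: card_PiE)
      also have "\<dots> \<le> (\<Prod>i\<in>J1 - {j}. f)" using F(3) J1(1) by (intro prod_mono) auto
      also have "\<dots> = f ^ (d - 1)" using j J1(2) by simp
      finally show "card (PiE (J1 - {j}) F) \<le> f ^ (d - 1)" .
    qed
    finally show ?thesis using J1(2) by simp
  qed
  have "\<exists>u. norm u = 1 \<and> (\<forall>x\<in>g ` (J1 - {j}). u \<bullet> x = 0)" if "j \<in> J1" for j and g :: "'j \<Rightarrow> 'a"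
  proof (rule ex_unit_orthogonal)
    have "card (g ` (J1 - {j})) \<le> card (J1 - {j})" using fin by (intro card_image_le) auto
    also have "\<dots> < DIM('a)" using that J1(2) d by (simp add: d_def)
    finally show "card (g ` (J1 - {j})) < DIM('a)" .
  qed (use fin in auto)
  note ex_U = this
  \<comment> \<open>A normal is fixed for every omitted colour and every partial choice in advance,
    since \<open>a\<close> has to be known before \<open>s\<close> is selected. If the points of
    \<open>g\<close> are dependent, any normal serves.\<close>
  define U where "U j g = (SOME u. norm u = 1 \<and> (\<forall>x\<in>g ` (J1 - {j}). u \<bullet> x = 0))"
    for j and g :: "'j \<Rightarrow> 'a"
  have U: "norm (U j g) = 1" "i \<in> J1 - {j} \<Longrightarrow> U j g \<bullet> g i = 0" if "j \<in> J1" for j i and g :: "'j \<Rightarrow> 'a"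
    using someI_ex[OF ex_U[OF that, of g]] by (auto simp: U_def)
  obtain a where a: "norm a \<le> card N * w" "\<And>k. k \<in> N \<Longrightarrow> w \<le> \<bar>a \<bullet> (case k of (j, g) \<Rightarrow> U j g)\<bar>"
    by (rule bang_signs[OF finN _ w, of "\<lambda>(j, g). U j g"]) (auto simp: N_def U(1))
  have "card N * w \<le> real (d * f ^ (d - 1)) * w"
    using cardN w by (intro mult_right_mono) (auto simp flip: of_nat_mult of_nat_power)
  also have "\<dots> = \<rho>" using d f0 by (simp add: w_def)
  finally have a\<rho>: "norm a \<le> \<rho>" using a(1) by simp
  have "\<exists>s. (\<forall>j\<in>J1. s j \<in> F j) \<and> a \<in> convex hull (insert 0 (s ` J1))"
    using F(4) J1 fin a\<rho> \<rho>
    by (intro colourful_caratheodory_base[where K = "cball 0 \<rho>"]) (auto simp: d_def)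
  then obtain s where s: "\<And>j. j \<in> J1 \<Longrightarrow> s j \<in> F j" and a_s: "a \<in> convex hull (insert 0 (s ` J1))"
    by blast
  obtain \<beta> where \<beta>: "\<And>j. j \<in> J1 \<Longrightarrow> 0 \<le> \<beta> j" "sum \<beta> J1 \<le> 1" "a = (\<Sum>j\<in>J1. \<beta> j *\<^sub>R s j)"
  proof -
    have "s ` J1 \<noteq> {}" using j1 by auto
    then obtain p q b where pq: "0 \<le> p" "0 \<le> q" "p + q = 1" "b \<in> convex hull (s ` J1)" "a = q *\<^sub>R b"
      using a_s by (auto simp: convex_hull_insert)
    then obtain \<beta> where "b = (\<Sum>j\<in>J1. \<beta> j *\<^sub>R s j)" "\<forall>j\<in>J1. 0 \<le> \<beta> j" "sum \<beta> J1 = 1"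
      unfolding convex_hull_finite_image[OF fin(1)] by blast
    then show thesis using pq that[of "\<lambda>j. q * \<beta> j"]
      by (auto simp: scaleR_sum_right sum_distrib_left[symmetric])
  qed
  define u where "u j = U j (restrict s (J1 - {j}))" for j
  have u: "norm (u j) = 1" "w \<le> \<bar>a \<bullet> u j\<bar>" if "j \<in> J1" for j
    using U(1)[OF that] a(2)[of "(j, restrict s (J1 - {j}))"] that s by (auto simp: u_def N_def)
  have us: "u j \<bullet> s i = 0" if "j \<in> J1" "i \<in> J1" "i \<noteq> j" for i j
    using U(2)[of j i "restrict s (J1 - {j})"] that by (simp add: u_def)
  have au: "a \<bullet> u j = \<beta> j * (u j \<bullet> s j)" if j: "j \<in> J1" for j
  proof -
    have "a \<bullet> u j = u j \<bullet> (\<Sum>i\<in>J1. \<beta> i *\<^sub>R s i)" using \<beta>(3) by (simp add: inner_commute)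
    also have "\<dots> = (\<Sum>i\<in>J1. \<beta> i * (u j \<bullet> s i))" by (simp add: inner_sum_right)
    also have "\<dots> = (\<Sum>i\<in>J1. if i = j then \<beta> j * (u j \<bullet> s j) else 0)"
      using us[OF j] by (intro sum.cong) auto
    finally show ?thesis using fin j by simp
  qed
  \<comment> \<open>Depth at least \<open>w > 0\<close> excludes both a vanishing weight and a point
    in the span of the others: the chosen points form a basis, and \<sigma> is its dual
    basis.\<close>
  have pos: "0 < \<beta> j" "u j \<bullet> s j \<noteq> 0" if "j \<in> J1" for j
    using u(2)[OF that] au[OF that] w \<beta>(1)[OF that] by (auto simp: less_le)
  define \<sigma> where "\<sigma> j = u j /\<^sub>R (u j \<bullet> s j)" for j
  have bi: "\<sigma> i \<bullet> s j = (if i = j then 1 else 0)" if "i \<in> J1" "j \<in> J1" for i j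
    using us[of i j] pos(2)[OF that(1)] that by (auto simp: \<sigma>_def)
  have \<sigma>\<beta>: "w * norm (\<sigma> j) \<le> \<beta> j" if "j \<in> J1" for j
  proof -
    have "norm (\<sigma> j) = 1 / \<bar>u j \<bullet> s j\<bar>" using u(1)[OF that] by (simp add: \<sigma>_def divide_inverse)
    moreover have "w \<le> \<beta> j * \<bar>u j \<bullet> s j\<bar>"
      using u(2)[OF that] au[OF that] \<beta>(1)[OF that] by (simp add: abs_mult)
    ultimately show ?thesis using pos(2)[OF that] by (simp add: pos_divide_le_eq)
  qed
  have a0: "a \<noteq> 0" using u(2)[OF j1] w by auto
  define \<kappa> where "\<kappa> = 1 / norm a"
  have \<kappa>: "0 < \<kappa>" "1 / \<kappa> \<le> \<rho>" "norm (- (\<kappa> *\<^sub>R a)) = 1" using a0 a\<rho> by (auto simp: \<kappa>_def)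
  have "\<exists>s'. (\<forall>j\<in>J2. s' j \<in> S j) \<and> - (\<kappa> *\<^sub>R a) \<in> convex hull (insert (s j1) (s' ` J2))"
    using S fin J2 \<kappa>(3)
    by (intro colourful_caratheodory_base[where K = "cball 0 1"]) (auto simp: d_def J2_def)
  then obtain s' where s': "\<And>j. j \<in> J2 \<Longrightarrow> s' j \<in> S j"
    "- (\<kappa> *\<^sub>R a) \<in> convex hull (insert (s j1) (s' ` J2))" by blast
  define t where "t j = (if j \<in> J1 then s j else s' j)" for j
  define C where "C = convex hull (t ` J)"
  have C: "convex C" by (simp add: C_def)
  have sC: "s j \<in> C" if "j \<in> J1" for j
    using that J1(1) by (auto simp: C_def t_def intro!: hull_inc image_eqI[of _ _ j])
  have "insert (s j1) (s' ` J2) \<subseteq> t ` J" using j1 J1(1) by (force simp: t_def J2_def)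
  then have aC: "- (\<kappa> *\<^sub>R a) \<in> C" using s'(2) hull_mono unfolding C_def by blast
  define B where "B = sum \<beta> J1"
  have B: "0 < B" using pos(1) fin j1 unfolding B_def by (intro sum_pos) auto
  have zeroC: "0 \<in> C"
  proof -
    have "(\<Sum>j\<in>J1. (\<beta> j / B) *\<^sub>R s j) \<in> C"
      using fin C sC \<beta>(1) B
      by (intro convex_sum) (auto simp: sum_divide_distrib[symmetric] B_def)
    then have aB: "(1 / B) *\<^sub>R a \<in> C" by (simp add: \<beta>(3) scaleR_sum_right)
    \<comment> \<open>0 lies on the segment from \<open>- \<kappa> a\<close> to
      \<open>a / B\<close>; \<open>x\<close> is the weight at which the two multiples of
      \<open>a\<close> cancel.\<close>
    define x where "x = 1 / (1 + \<kappa> * B)"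
    have \<kappa>B: "0 < \<kappa> * B" "1 + \<kappa> * B \<noteq> 0" using \<kappa>(1) B by (simp_all add: add_pos_pos less_imp_neq[symmetric])
    then have x: "0 \<le> x" "x \<le> 1" "(1 - x) / B = x * \<kappa>"
      using B by (simp_all add: x_def divide_simps)
    have "x *\<^sub>R - (\<kappa> *\<^sub>R a) + (1 - x) *\<^sub>R (1 / B) *\<^sub>R a \<in> C"
      using aC aB C x by (intro convexD) auto
    then show ?thesis using x(3) by simp
  qed
  have "cball 0 (w / (2 + \<rho>)) \<subseteq> C"
  proof
    fix x :: 'a assume "x \<in> cball 0 (w / (2 + \<rho>))"
    then have x: "norm x * (2 + \<rho>) \<le> w" using \<rho> by (simp add: pos_le_divide_eq)
    \<comment> \<open>Adding \<open>norm x / w\<close> times \<open>a\<close> makes every coordinate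
      of \<open>x\<close> in the basis nonnegative, because
      \<open>w * norm (\<sigma> j) \<le> \<beta> j\<close>; \<theta> is the weight of
      \<open>- \<kappa> a\<close> that cancels the addition. The total weight is at most
      \<open>norm x * (2 + \<rho>) / w\<close>, the origin of the factor \<open>2 + \<rho>\<close>
      in the radius.\<close>
    define \<theta> where "\<theta> = norm x / (\<kappa> * w)"
    define c where "c j = \<sigma> j \<bullet> x + norm x / w * \<beta> j" for j
    have \<sigma>x: "\<bar>\<sigma> j \<bullet> x\<bar> \<le> norm x / w * \<beta> j" if "j \<in> J1" for j
    proof -
      have "\<bar>\<sigma> j \<bullet> x\<bar> \<le> norm (\<sigma> j) * norm x" by (rule Cauchy_Schwarz_ineq2)
      also have "\<dots> \<le> (\<beta> j / w) * norm x"
        using \<sigma>\<beta>[OF that] w by (intro mult_right_mono) (auto simp: pos_le_divide_eq mult.commute)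
      finally show ?thesis by (simp add: mult.commute)
    qed
    have c0: "0 \<le> c j" if "j \<in> J1" for j using \<sigma>x[OF that] by (simp add: c_def)
    have "sum c J1 \<le> (\<Sum>j\<in>J1. 2 * (norm x / w) * \<beta> j)"
      using \<sigma>x by (intro sum_mono) (force simp: c_def)
    also have "\<dots> = 2 * (norm x / w) * B" by (simp add: B_def sum_distrib_left)
    also have "\<dots> \<le> 2 * (norm x / w) * 1"
      using \<beta>(2) w by (intro mult_left_mono) (auto simp: B_def)
    finally have csum: "sum c J1 + \<theta> \<le> norm x * (2 + 1 / \<kappa>) / w"
      by (simp add: \<theta>_def add_divide_distrib algebra_simps)
    also have "\<dots> \<le> norm x * (2 + \<rho>) / w"
      using \<kappa> w by (intro divide_right_mono mult_left_mono) auto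
    also have "\<dots> \<le> 1" using x w by simp
    finally have c1: "sum c J1 + \<theta> \<le> 1" .
    have "x = (\<Sum>j\<in>J1. (\<sigma> j \<bullet> x) *\<^sub>R s j)"
      using fin J1(2) bi by (intro biorthogonal_expansion) (auto simp: d_def)
    moreover have "(norm x / w) *\<^sub>R a = (\<Sum>j\<in>J1. (norm x / w * \<beta> j) *\<^sub>R s j)"
      by (subst \<beta>(3)) (simp add: scaleR_sum_right)
    moreover have "(norm x / w) *\<^sub>R a = \<theta> *\<^sub>R \<kappa> *\<^sub>R a" using \<kappa>(1) by (simp add: \<theta>_def)
    ultimately have "x = (\<Sum>j\<in>J1. c j *\<^sub>R s j) + \<theta> *\<^sub>R - (\<kappa> *\<^sub>R a)"
      by (simp add: c_def scaleR_add_left sum.distrib)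
    also have "\<dots> = (\<Sum>i\<in>insert None (Some ` J1). (case i of None \<Rightarrow> \<theta> | Some j \<Rightarrow> c j)
        *\<^sub>R (case i of None \<Rightarrow> - (\<kappa> *\<^sub>R a) | Some j \<Rightarrow> s j))"
      using fin by (subst sum.insert) (auto simp: sum.reindex add.commute)
    also have "\<dots> \<in> C"
      using fin C zeroC c0 c1 sC aC \<kappa> w
      by (intro convex_sum_subprob) (auto simp: sum.reindex \<theta>_def)
    finally show "x \<in> C" .
  qed
  moreover have "\<forall>j\<in>J. t j \<in> S j" using s s' F(2) J1(1) by (auto simp: t_def J2_def)
  ultimately show ?thesis unfolding C_def w_def by blast
qed

text \<open>The growth of (d^2 + 1)^(d - 1) against d^(2 d - 2) is at most 4/3 by Bernoulli, 4 d + 1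
  \<le> 9/8 d^3 is an equality at d = 2, and their product 3/2 is below 7/4, while pi / e^2 \<le>
  4/7. The inequality fails for d = 1, where the right-hand side is 1/5.\<close>

lemma steinitz_constant:
  fixes d :: nat
  assumes "2 \<le> d"
  defines "\<rho> \<equiv> 1 / (2 * real d)"
  shows "pi / exp 1 ^ 2 * real d powi (- 2 * int d - 2)
    \<le> \<rho> / (d * (d * d + 1) ^ (d - 1)) / (2 + \<rho>)"
proof -
  define D where "D = real d"
  define n where "n = d - 1"
  have D: "2 \<le> D" using assms(1) by (simp add: D_def)
  have d: "d = Suc n" using assms(1) by (simp add: n_def)
  have powi: "real d powi (- 2 * int d - 2) = 1 / (D ^ 4 * (D * D) ^ n)"
  proof -
    have "- 2 * int d - 2 = - int (2 * d + 2)" by simp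
    then have "real d powi (- 2 * int d - 2) = 1 / D ^ (2 * d + 2)"
      by (simp only: power_int_minus power_int_of_nat D_def inverse_eq_divide)
    also have "2 * d + 2 = 4 + 2 * n" by (simp add: d)
    also have "D ^ (4 + 2 * n) = D ^ 4 * (D * D) ^ n"
      by (simp only: power_add power_mult power2_eq_square)
    finally show ?thesis .
  qed
  have "7 \<le> exp (1 :: real) ^ 2"
  proof -
    have "(\<Sum>i<5. inverse (fact i) *\<^sub>R (1::real) ^ i) \<le> (\<Sum>i. inverse (fact i) *\<^sub>R (1::real) ^ i)"
      by (rule sum_le_suminf[OF summable_exp_generic]) auto
    then have "(\<Sum>i<5. inverse (fact i) *\<^sub>R (1::real) ^ i) \<le> exp 1" by (simp add: exp_def)
    then have "2.7 \<le> exp (1::real)" by (simp add: eval_nat_numeral)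
    then have "2.7 ^ 2 \<le> exp (1 :: real) ^ 2" by (intro power_mono) auto
    then show ?thesis by (simp add: power2_eq_square)
  qed
  then have e: "pi / exp 1 ^ 2 \<le> 4 / 7"
    using pi_less_4 by (intro frac_le) auto
  have bernoulli: "(D * D + 1) ^ n \<le> 4 / 3 * (D * D) ^ n"
  proof -
    define x where "x = 1 / (D * D + 1)"
    have x: "0 < x" "x \<le> 1" using D by (auto simp: x_def divide_simps add_pos_pos)
    have "1 + real n * (- x) \<le> (1 + - x) ^ n" using x by (intro Bernoulli_inequality) auto
    moreover have "3 / 4 \<le> 1 + real n * (- x)"
    proof -
      have "0 \<le> (D - 2) ^ 2" by simp
      then have "4 * (D - 1) \<le> D * D" by (simp add: power2_eq_square algebra_simps)
      then have "(D - 1) * x \<le> 1 / 4" using D by (simp add: x_def divide_simps add_pos_pos)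
      moreover have "real n = D - 1" by (simp add: D_def d)
      ultimately show ?thesis by simp
    qed
    moreover have "1 + - x = D * D / (D * D + 1)"
    proof -
      have "D * D + 1 \<noteq> 0" using zero_le_square[of D] by linarith
      then have "1 + - x = (D * D + 1) / (D * D + 1) - 1 / (D * D + 1)" by (simp add: x_def)
      also have "\<dots> = D * D / (D * D + 1)" by (simp only: diff_divide_distrib[symmetric]) simp
      finally show ?thesis .
    qed
    ultimately have "3 / 4 \<le> (D * D / (D * D + 1)) ^ n" by simp
    then have "3 / 4 \<le> (D * D) ^ n / (D * D + 1) ^ n" by (simp add: power_divide)
    moreover have "0 < (D * D + 1) ^ n" using D by (simp add: add_pos_pos)
    ultimately show ?thesis by (simp add: pos_le_divide_eq)
  qed
  have lin: "4 * D + 1 \<le> 9 / 8 * D ^ 3"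
  proof -
    have "4 \<le> D * D" using D mult_mono[of 2 D 2 D] by simp
    then have "D * 4 \<le> D * (D * D)" using D by (intro mult_left_mono) auto
    moreover have "D ^ 3 = D * (D * D)" by (simp add: power3_eq_cube)
    ultimately show ?thesis using D by linarith
  qed
  have "\<rho> / (d * (d * d + 1) ^ (d - 1)) / (2 + \<rho>) = 1 / ((4 * D + 1) * (D * (D * D + 1) ^ n))"
  proof -
    have "\<rho> / (2 + \<rho>) = 1 / (4 * D + 1)" using D by (simp add: \<rho>_def D_def[symmetric] field_simps)
    moreover have "real (d * (d * d + 1) ^ (d - 1)) = D * (D * D + 1) ^ n"
      by (simp add: D_def n_def add.commute)
    moreover have "\<rho> / E / (2 + \<rho>) = \<rho> / (2 + \<rho>) / E" for E by simp
    ultimately show ?thesis by (simp only: divide_divide_eq_left)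
  qed
  moreover have "pi / exp 1 ^ 2 * (1 / (D ^ 4 * (D * D) ^ n)) \<le> 4 / 7 * (1 / (D ^ 4 * (D * D) ^ n))"
    using e D by (intro mult_right_mono) auto
  moreover have "4 / 7 * (1 / (D ^ 4 * (D * D) ^ n)) \<le> 1 / ((4 * D + 1) * (D * (D * D + 1) ^ n))"
  proof -
    have "(4 * D + 1) * (D * (D * D + 1) ^ n) \<le> 9 / 8 * D ^ 3 * (D * (4 / 3 * (D * D) ^ n))"
      using lin bernoulli D by (intro mult_mono) auto
    also have "\<dots> = 3 / 2 * (D ^ 4 * (D * D) ^ n)" by (simp add: eval_nat_numeral)
    also have "\<dots> \<le> 7 / 4 * (D ^ 4 * (D * D) ^ n)" using D by (intro mult_right_mono) auto
    finally have "1 / (7 / 4 * (D ^ 4 * (D * D) ^ n)) \<le> 1 / ((4 * D + 1) * (D * (D * D + 1) ^ n))"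
      using D by (intro frac_le) (auto simp: add_pos_pos)
    then show ?thesis by simp
  qed
  ultimately show ?thesis unfolding powi by linarith
qed

text \<open>In dimension one the segment between the two unit vectors is itself the unit ball, and
  covering it takes only 2 colours. This replaces the general radius, which would be too small
  there.\<close>

theorem colourful_steinitz:
  fixes S :: "'j \<Rightarrow> (real ^ 'd) set"
  assumes J: "finite J" "card J = 2 * CARD('d)"
    and S: "\<And>j. j \<in> J \<Longrightarrow> cball 0 1 \<subseteq> convex hull (S j)"
  shows "\<exists>s. (\<forall>j\<in>J. s j \<in> S j) \<and>
    cball 0 (pi / exp 1 ^ 2 * real CARD('d) powi (- 2 * int CARD('d) - 2)) \<subseteq> convex hull (s ` J)"
proof (cases "CARD('d) = 1")
  case True
  then obtain i :: 'd where i: "UNIV = {i}" by (auto simp: card_1_singleton_iff)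
  define V :: "(real ^ 'd) set" where "V = {axis i 1, - axis i 1}"
  have "cball 0 1 \<subseteq> convex hull V"
  proof
    fix x :: "real ^ 'd" assume "x \<in> cball 0 1"
    then have "\<bar>x $ i\<bar> \<le> 1" using component_le_norm_cart[of x i] by simp
    then have "((1 + x $ i) / 2) *\<^sub>R axis i 1 + ((1 - x $ i) / 2) *\<^sub>R - axis i 1 \<in> convex hull V"
      by (intro convexD) (auto simp: V_def hull_inc add_divide_distrib[symmetric])
    moreover have "x = ((1 + x $ i) / 2) *\<^sub>R axis i 1 + ((1 - x $ i) / 2) *\<^sub>R - axis i 1"
      using i by (auto simp: vec_eq_iff axis_def field_simps)
    ultimately show "x \<in> convex hull V" by simp
  qed
  moreover have "(card V - 1) * CARD('d) < card J"
    using card_insert_le_m1[of 2 "{- axis i (1::real) :: real ^ 'd}"] True J(2)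
    by (simp add: V_def card_insert_if)
  ultimately obtain s where s: "\<forall>j\<in>J. s j \<in> S j" "cball 0 1 \<subseteq> convex hull (s ` J)"
    using colourful_hull_contains_ball[of V 1 J S] J(1) S by (auto simp: V_def norm_axis_1)
  have "pi / exp 1 ^ 2 \<le> 1"
  proof -
    have "2 \<le> exp (1::real)" using exp_ge_add_one_self[of 1] by simp
    then have "2 ^ 2 \<le> exp (1 :: real) ^ 2" by (intro power_mono) auto
    then show ?thesis using pi_less_4 by simp
  qed
  then have "cball 0 (pi / exp 1 ^ 2 * real CARD('d) powi (- 2 * int CARD('d) - 2)) \<subseteq>
      (cball 0 1 :: (real ^ 'd) set)" using True by (intro subset_cball) simp
  then show ?thesis using s by blast
next
  case False
  then have d: "2 \<le> CARD('d)" using one_le_card_finite[where 'a='d] by linarith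
  have "\<exists>F. finite F \<and> F \<subseteq> S j \<and> card F \<le> CARD('d) * CARD('d) + 1 \<and>
      cball 0 (1 / (2 * real CARD('d))) \<subseteq> convex hull F" if "j \<in> J" for j
    using few_points_hull_contains_ball[OF S[OF that]] by metis
  then obtain s where s: "\<forall>j\<in>J. s j \<in> S j"
    "cball 0 (1 / (2 * real CARD('d)) / (CARD('d) * (CARD('d) * CARD('d) + 1) ^ (CARD('d) - 1))
      / (2 + 1 / (2 * real CARD('d)))) \<subseteq> convex hull (s ` J)"
    using colourful_steinitz_few_points[of J S "1 / (2 * real CARD('d))" "CARD('d) * CARD('d) + 1"] J S by auto
  then show ?thesis using subset_cball[OF steinitz_constant[OF d]] by blast
qed

section \<open>Approximation by polytopes with few vertices\<close>

lemma symmetric_convex_contains_ball: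
  fixes K :: "'a::real_normed_vector set"
  assumes "convex K" "\<And>x. x \<in> K \<Longrightarrow> - x \<in> K" "interior K \<noteq> {}"
  obtains e where "0 < e" "cball 0 e \<subseteq> K"
proof -
  obtain x e where e: "0 < e" "cball x e \<subseteq> K" using assms(3) by (force simp: mem_interior_cball)
  show thesis
  proof (rule that[OF e(1)], rule subsetI)
    fix y :: 'a assume y: "y \<in> cball 0 e"
    then have "x + y \<in> K" "- (x - y) \<in> K" using e(2) by (auto simp: dist_norm intro!: assms(2)[of "x - y", simplified])
    then have "(1/2) *\<^sub>R (x + y) + (1/2) *\<^sub>R - (x - y) \<in> K"
      using assms(1) by (intro convexD) auto
    then show "y \<in> K" by (simp add: algebra_simps flip: scaleR_add_left)
  qed
qed

lemma compact_rows:
  fixes K :: "(real ^ 'd) set"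
  assumes "compact K"
  shows "compact {A :: real ^ 'd ^ 'n. \<forall>i. A $ i \<in> K}"
proof -
  have "closed {A :: real ^ 'd ^ 'n. A $ i \<in> K}" for i
    using closed_vimage_vec_nth[OF compact_imp_closed[OF assms], of i] by (simp add: vimage_def)
  then have "closed {A :: real ^ 'd ^ 'n. \<forall>i. A $ i \<in> K}" by (rule closed_Collect_all)
  moreover obtain M where M: "\<And>x. x \<in> K \<Longrightarrow> norm x \<le> M"
    using compact_imp_bounded[OF assms] by (auto simp: bounded_iff)
  have "norm A \<le> CARD('n) * M" if "\<forall>i. A $ i \<in> K" for A :: "real ^ 'd ^ 'n"
  proof -
    have "norm A \<le> (\<Sum>i\<in>UNIV. norm (A $ i))" unfolding norm_vec_def by (intro L2_set_le_sum) auto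
    also have "\<dots> \<le> (\<Sum>i\<in>(UNIV :: 'n set). M)" using M that by (intro sum_mono) auto
    finally show ?thesis by simp
  qed
  then have "bounded {A :: real ^ 'd ^ 'n. \<forall>i. A $ i \<in> K}" by (auto simp: bounded_iff)
  ultimately show ?thesis by (simp add: compact_eq_bounded_closed)
qed

text \<open>Rows of maximal determinant form an Auerbach basis: by Cramer's rule, replacing the
  \<open>k\<close>-th row by a point of \<open>K\<close> multiplies the determinant by the \<open>k\<close>-th coordinate of that point.\<close>

lemma auerbach_position:
  fixes K :: "(real ^ 'd) set"
  assumes K: "compact K" "convex K" "\<And>x. x \<in> K \<Longrightarrow> - x \<in> K" "interior K \<noteq> {}"
  obtains \<Lambda> :: "real ^ 'd \<Rightarrow> real ^ 'd" where "linear \<Lambda>" "bij \<Lambda>"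
    "\<And>y i. y \<in> \<Lambda> ` K \<Longrightarrow> \<bar>y $ i\<bar> \<le> 1" "\<And>i. axis i 1 \<in> \<Lambda> ` K"
proof -
  define X where "X = {A :: real ^ 'd ^ 'd. \<forall>i. A $ i \<in> K}"
  obtain e where e: "0 < e" "cball 0 e \<subseteq> K"
    using symmetric_convex_contains_ball[OF K(2,3,4)] by blast
  \<comment> \<open>A nondegenerate competitor, so that the maximal determinant is not 0.\<close>
  define E :: "real ^ 'd ^ 'd" where "E = (\<chi> i. e *\<^sub>R axis i 1)"
  have EX: "E \<in> X" using e by (auto simp: X_def E_def norm_axis_1)
  have "det E = (\<Prod>i\<in>(UNIV::'d set). E $ i $ i)"
    by (rule det_diagonal) (auto simp: E_def axis_def)
  also have "\<dots> \<noteq> 0" using e by (simp add: E_def axis_def)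
  finally have detE: "det E \<noteq> 0" .
  have "continuous_on X (\<lambda>A. \<bar>det A\<bar>)" unfolding det_def by (intro continuous_intros)
  then obtain A where A: "A \<in> X" "\<And>B. B \<in> X \<Longrightarrow> \<bar>det B\<bar> \<le> \<bar>det A\<bar>"
    using continuous_attains_sup[of X "\<lambda>A. \<bar>det A\<bar>"] EX compact_rows[OF K(1)]
    by (auto simp: X_def)
  have detA: "det A \<noteq> 0" using A(2)[OF EX] detE by auto
  then have "invertible (transpose A)" by (simp add: invertible_det_nz)
  then obtain B where B: "transpose A ** B = mat 1" "B ** transpose A = mat 1"
    by (auto simp: invertible_def)
  \<comment> \<open>\<open>transpose A\<close> sends the coordinate vectors to the rows of
    \<open>A\<close>; its inverse puts these rows on the axes.\<close>
  define \<Lambda> where "\<Lambda> x = B *v x" for x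
  have inv: "transpose A *v \<Lambda> x = x" "\<Lambda> (transpose A *v x) = x" for x
    using B by (simp_all only: \<Lambda>_def matrix_vector_mul_assoc matrix_vector_mul_lid)
  show thesis
  proof (rule that[of \<Lambda>])
    show "linear \<Lambda>" unfolding \<Lambda>_def by simp
    show "bij \<Lambda>" by (rule bij_betw_byWitness[of _ "(*v) (transpose A)"]) (auto simp: inv simp del: transpose_matrix_vector)
    show "axis i 1 \<in> \<Lambda> ` K" for i
    proof -
      have "transpose A *v axis i 1 = A $ i"
        by (simp add: matrix_vector_mul_component vec_eq_iff matrix_vector_mult_basis column_def transpose_def)
      then have "\<Lambda> (A $ i) = axis i 1" using inv(2)[of "axis i 1"] by simp
      then show ?thesis using A(1) by (intro image_eqI[of _ _ "A $ i"]) (auto simp: X_def)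
    qed
    fix y i assume "y \<in> \<Lambda> ` K"
    then obtain x where x: "x \<in> K" "y = \<Lambda> x" by auto
    define R where "R = (\<chi> j. if j = i then (\<Sum>l\<in>UNIV. y $ l *s row l A) else row j A)"
    have "(\<Sum>l\<in>UNIV. y $ l *s row l A) = transpose A *v y"
      by (simp add: matrix_mult_sum column_transpose)
    also have "\<dots> = x" using x inv by simp
    finally have "R \<in> X" using A(1) x by (auto simp: X_def R_def row_def vec_lambda_eta)
    then have "\<bar>det R\<bar> \<le> \<bar>det A\<bar>" by (rule A(2))
    moreover have "det R = y $ i * det A" unfolding R_def by (rule cramer_lemma_transpose)
    ultimately show "\<bar>y $ i\<bar> \<le> 1" using detA by (simp add: abs_mult)
  qed
qed

text \<open>Net centres may lie outside \<open>L\<close>, so nearby points of \<open>L\<close>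
  replace them at distance up to \<open>2 * \<delta>\<close> from what they approximate. For a
  separating functional with maximum \<open>h\<close> on \<open>L\<close>, the inner ball bounds its
  norm by \<open>h / \<rho>\<close>, so passing from a maximiser to a net point loses at most the
  share \<epsilon> / (1 + \<epsilon>) of \<open>h\<close>.\<close>

lemma polytope_approximation:
  fixes L :: "'a::euclidean_space set"
  assumes L: "compact L" "convex L" and ball: "cball 0 \<rho> \<subseteq> L" "0 < \<rho>"
    and Z: "finite Z" "L \<subseteq> (\<Union>z\<in>Z. ball z \<delta>)" and \<delta>: "2 * \<delta> / \<rho> \<le> \<epsilon> / (1 + \<epsilon>)" and \<epsilon>: "0 < \<epsilon>"
  obtains P where "polytope P" "card {v. v extreme_point_of P} \<le> card Z"
    "P \<subseteq> L" "L \<subseteq> (\<lambda>x. (1 + \<epsilon>) *\<^sub>R x) ` P"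
proof -
  define Z' where "Z' = {z\<in>Z. ball z \<delta> \<inter> L \<noteq> {}}"
  have Z': "finite Z'" "Z' \<subseteq> Z" using Z(1) by (auto simp: Z'_def)
  have "\<forall>z\<in>Z'. \<exists>p. p \<in> ball z \<delta> \<inter> L" by (auto simp: Z'_def)
  then obtain g where g: "\<And>z. z \<in> Z' \<Longrightarrow> g z \<in> ball z \<delta> \<inter> L" by metis
  define P where "P = convex hull (g ` Z')"
  have P: "P \<subseteq> L" unfolding P_def using g L(2) by (intro hull_minimal) auto
  have cP: "convex P" "closed P"
    using Z'(1) by (auto simp: P_def intro: compact_imp_closed finite_imp_compact_convex_hull)
  have "{v. v extreme_point_of P} \<subseteq> g ` Z'" unfolding P_def by (auto dest: extreme_point_of_convex_hull)
  then have "card {v. v extreme_point_of P} \<le> card (g ` Z')" using Z'(1) by (intro card_mono) auto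
  also have "\<dots> \<le> card Z'" using Z'(1) by (rule card_image_le)
  also have "\<dots> \<le> card Z" using Z Z' by (intro card_mono)
  finally have cardP: "card {v. v extreme_point_of P} \<le> card Z" .
  have L0: "L \<noteq> {}" using ball by auto
  have "L \<subseteq> (\<lambda>x. (1 + \<epsilon>) *\<^sub>R x) ` P"
  proof
    fix y assume y: "y \<in> L"
    define x where "x = y /\<^sub>R (1 + \<epsilon>)"
    have "x \<in> P"
    proof (rule ccontr)
      assume "x \<notin> P"
      then obtain a b where "a \<bullet> x < b" "\<forall>p\<in>P. b < a \<bullet> p"
        using separating_hyperplane_closed_point[OF cP] by blast
      then have sep: "(- a) \<bullet> p < (- a) \<bullet> x" if "p \<in> P" for p using that by fastforce
      define n where "n = - a"
      obtain m where m: "m \<in> L" "\<And>z. z \<in> L \<Longrightarrow> n \<bullet> z \<le> n \<bullet> m"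
        using continuous_attains_sup[OF L(1) L0 continuous_on_inner[OF continuous_on_const continuous_on_id]]
        by blast
      define h where "h = n \<bullet> m"
      have "\<rho> * norm n \<le> h"
      proof -
        define r where "r = (\<rho> / norm n) *\<^sub>R n"
        have "norm r \<le> \<rho>" using ball(2) by (simp add: r_def)
        then have "n \<bullet> r \<le> h" using m(2) ball(1) by (auto simp: h_def)
        moreover have "n \<bullet> r = \<rho> * norm n"
          by (cases "n = 0") (auto simp: r_def dot_square_norm power2_eq_square)
        ultimately show ?thesis by simp
      qed
      then have nh: "norm n \<le> h / \<rho>" using ball(2) by (simp add: pos_le_divide_eq mult.commute)
      then have h: "0 \<le> h" using ball(2) norm_ge_zero[of n] by (meson order_trans zero_le_divide_iff not_le)
      obtain z where z: "z \<in> Z" "m \<in> ball z \<delta>" using Z(2) m(1) by auto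
      then have zZ': "z \<in> Z'" using m(1) by (auto simp: Z'_def)
      have p: "g z \<in> P" using zZ' by (simp add: P_def hull_inc)
      have "dist (g z) m \<le> dist z (g z) + dist z m" by (rule dist_triangle3)
      also have "\<dots> \<le> 2 * \<delta>" using g[OF zZ'] z(2) by auto
      finally have "norm (m - g z) \<le> 2 * \<delta>" by (simp add: dist_norm norm_minus_commute)
      then have "norm n * norm (m - g z) \<le> (h / \<rho>) * (2 * \<delta>)"
        using nh h ball(2) by (intro mult_mono) auto
      also have "\<dots> = h * (2 * \<delta> / \<rho>)" by simp
      also have "\<dots> \<le> h * (\<epsilon> / (1 + \<epsilon>))" using h \<delta> by (intro mult_left_mono)
      finally have "n \<bullet> (m - g z) \<le> h * (\<epsilon> / (1 + \<epsilon>))" using norm_cauchy_schwarz[of n "m - g z"] by linarith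
      moreover have "n \<bullet> g z < n \<bullet> x" using sep[OF p] by (simp add: n_def)
      moreover have "n \<bullet> x \<le> h / (1 + \<epsilon>)"
        using m(2)[OF y] \<epsilon> by (simp add: x_def h_def divide_inverse mult.commute)
      moreover have "h * (\<epsilon> / (1 + \<epsilon>)) + h / (1 + \<epsilon>) = h"
      proof -
        have "h * (\<epsilon> / (1 + \<epsilon>)) + h / (1 + \<epsilon>) = (h * \<epsilon> + h) / (1 + \<epsilon>)"
          by (simp add: add_divide_distrib)
        also have "h * \<epsilon> + h = h * (1 + \<epsilon>)" by (simp add: algebra_simps)
        finally show ?thesis using \<epsilon> by simp
      qed
      ultimately show False by (simp add: inner_diff_right h_def)
    qed
    moreover have "y = (1 + \<epsilon>) *\<^sub>R x" using \<epsilon> by (simp add: x_def)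
    ultimately show "y \<in> (\<lambda>x. (1 + \<epsilon>) *\<^sub>R x) ` P" by blast
  qed
  then show thesis using that[of P] P cardP Z'(1) by (auto simp: P_def polytope_def)
qed

text \<open>The minimum is meaningful only if one \<open>N\<close> serves all bodies. Auerbach
  position confines each of them between the ball of radius \<open>1 / d\<close> and the cube, so
  the size of a single finite net of the cube is such an \<open>N\<close>.\<close>

lemma n_bms_attained:
  fixes K :: "(real ^ 'd) set"
  assumes \<epsilon>: "0 < \<epsilon>" and K: "compact K" "convex K" "\<forall>x\<in>K. - x \<in> K" "0 < measure lebesgue K" "C2_boundary K"
  shows "\<exists>(P :: (real ^ 'd) set) (\<Lambda> :: real ^ 'd \<Rightarrow> real ^ 'd).
    polytope P \<and> card {v. v extreme_point_of P} \<le> n_bms TYPE('d) \<epsilon> \<and> linear \<Lambda> \<and> bij \<Lambda> \<and>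
    P \<subseteq> \<Lambda> ` K \<and> \<Lambda> ` K \<subseteq> (\<lambda>x. (1 + \<epsilon>) *\<^sub>R x) ` P"
proof -
  define d where "d = real CARD('d)"
  have d: "1 \<le> d" using one_le_card_finite[where 'a='d] by (simp add: d_def)
  define \<delta> where "\<delta> = \<epsilon> / (1 + \<epsilon>) / d / 2"
  have "0 < \<delta>" using \<epsilon> d by (simp add: \<delta>_def)
  then obtain Z where Z: "finite Z" "cbox (- 1) (1 :: real ^ 'd) \<subseteq> (\<Union>z\<in>Z. ball z \<delta>)"
    using compact_cbox[of "- 1 :: real ^ 'd" 1] unfolding compact_eq_totally_bounded by blast
  have ex: "\<exists>(P :: (real ^ 'd) set) (\<Lambda> :: real ^ 'd \<Rightarrow> real ^ 'd).
      polytope P \<and> card {v. v extreme_point_of P} \<le> card Z \<and> linear \<Lambda> \<and> bij \<Lambda> \<and>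
      P \<subseteq> \<Lambda> ` K \<and> \<Lambda> ` K \<subseteq> (\<lambda>x. (1 + \<epsilon>) *\<^sub>R x) ` P"
    if K: "compact K" "convex K" "\<forall>x\<in>K. - x \<in> K" "0 < measure lebesgue K" for K :: "(real ^ 'd) set"
  proof -
    have "interior K \<noteq> {}"
      using K(4) negligible_convex_interior[OF K(2)] negligible_imp_measure0 by fastforce
    then obtain \<Lambda> :: "real ^ 'd \<Rightarrow> real ^ 'd" where \<Lambda>: "linear \<Lambda>" "bij \<Lambda>"
      "\<And>y i. y \<in> \<Lambda> ` K \<Longrightarrow> \<bar>y $ i\<bar> \<le> 1" "\<And>i. axis i 1 \<in> \<Lambda> ` K"
      using auerbach_position[OF K(1,2)] K(3) by blast
    define L where "L = \<Lambda> ` K"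
    have L: "compact L" "convex L"
      using K \<Lambda>(1)
      by (auto simp: L_def linear_conv_bounded_linear
          intro: compact_continuous_image linear_continuous_on convex_linear_image)
    have sym: "- y \<in> L" if "y \<in> L" for y
    proof -
      from that obtain x where "x \<in> K" "y = \<Lambda> x" by (auto simp: L_def)
      then have "- x \<in> K" "- y = \<Lambda> (- x)" using K(3) linear_neg[OF \<Lambda>(1)] by auto
      then show ?thesis by (auto simp: L_def)
    qed
    \<comment> \<open>A point of this ball is the average of the \<open>d\<close> points
      \<open>d * x $ i\<close> on the axes, each on a segment between opposite points of
      \<open>L\<close>.\<close>
    have "cball 0 (1 / d) \<subseteq> L"
    proof
      fix x :: "real ^ 'd" assume "x \<in> cball 0 (1 / d)"
      then have x: "\<bar>d * x $ i\<bar> \<le> 1" for i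
      proof -
        have "d * \<bar>x $ i\<bar> \<le> d * (1 / d)"
          using component_le_norm_cart[of x i] \<open>x \<in> cball 0 (1 / d)\<close> d by (intro mult_left_mono) auto
        then show ?thesis using d by (simp add: abs_mult)
      qed
      have seg: "t *\<^sub>R axis i 1 \<in> L" if "\<bar>t\<bar> \<le> 1" for t and i :: 'd
      proof -
        have "((1 + t) / 2) *\<^sub>R axis i 1 + ((1 - t) / 2) *\<^sub>R - axis i 1 \<in> L"
          using L(2) \<Lambda>(4) sym that by (intro convexD) (auto simp: L_def add_divide_distrib[symmetric])
        moreover have "(1 + t) / 2 - (1 - t) / 2 = t" by (simp add: field_simps)
        ultimately show ?thesis by (simp flip: scaleR_diff_left)
      qed
      have "(\<Sum>i\<in>UNIV. (1 / d) *\<^sub>R ((d * x $ i) *\<^sub>R axis i 1)) \<in> L"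
        using L(2) seg x d by (intro convex_sum) (auto simp: d_def)
      also have "(\<Sum>i\<in>UNIV. (1 / d) *\<^sub>R ((d * x $ i) *\<^sub>R axis i 1)) = x"
        using d by (simp add: vec_eq_iff axis_def if_distrib[of "\<lambda>y. _ * y"] cong: if_cong)
      finally show "x \<in> L" .
    qed
    moreover have "L \<subseteq> cbox (- 1) 1" using \<Lambda>(3) by (force simp: L_def mem_box_cart abs_le_iff)
    then have "L \<subseteq> (\<Union>z\<in>Z. ball z \<delta>)" using Z(2) by blast
    moreover have "2 * \<delta> / (1 / d) \<le> \<epsilon> / (1 + \<epsilon>)" using d by (simp add: \<delta>_def)
    moreover have "0 < 1 / d" using d by simp
    ultimately obtain P where "polytope P" "card {v. v extreme_point_of P} \<le> card Z"
      "P \<subseteq> L" "L \<subseteq> (\<lambda>x. (1 + \<epsilon>) *\<^sub>R x) ` P"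
      using polytope_approximation[OF L _ _ Z(1) _ _ \<epsilon>] by blast
    then show ?thesis using \<Lambda>(1,2) unfolding L_def by blast
  qed
  define Q where "Q N \<longleftrightarrow> (\<forall>K :: (real ^ 'd) set.
        compact K \<and> convex K \<and> (\<forall>x\<in>K. - x \<in> K) \<and> 0 < measure lebesgue K \<and> C2_boundary K \<longrightarrow>
        (\<exists>(P :: (real ^ 'd) set) (\<Lambda> :: real ^ 'd \<Rightarrow> real ^ 'd).
           polytope P \<and> card {v. v extreme_point_of P} \<le> N \<and>
           linear \<Lambda> \<and> bij \<Lambda> \<and>
           P \<subseteq> \<Lambda> ` K \<and> \<Lambda> ` K \<subseteq> (\<lambda>x. (1 + \<epsilon>) *\<^sub>R x) ` P))" for N
  have "Q (card Z)" unfolding Q_def using ex by blast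
  then have "Q (LEAST N. Q N)" by (rule LeastI)
  also have "(LEAST N. Q N) = n_bms TYPE('d) \<epsilon>" unfolding Q_def n_bms_def ..
  finally show ?thesis using K unfolding Q_def by blast
qed

text \<open>Off the origin the sphere is a regular level set of \<open>x \<bullet> x - 1\<close>.
  The gradient depends linearly on \<open>x\<close>, so the second derivative is constant.\<close>

lemma C2_boundary_cball: "C2_boundary (cball 0 1 :: 'a::euclidean_space set)"
  unfolding C2_boundary_def
proof
  fix p :: 'a assume p: "p \<in> frontier (cball 0 1)"
  have deriv: "((\<lambda>x. x \<bullet> x - 1) has_derivative blinfun_apply (2 *\<^sub>R blinfun_inner_left x)) (at x)" for x :: 'a
    by (auto intro!: derivative_eq_intros simp: fun_eq_iff scaleR_blinfun.rep_eq inner_commute)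
  have C2: "C2_on (\<lambda>x. x \<bullet> x - 1) (- {0 :: 'a})"
    unfolding C2_on_def
  proof (intro exI conjI ballI)
    fix x :: 'a
    have bl: "bounded_linear (\<lambda>x :: 'a. 2 *\<^sub>R blinfun_inner_left x)"
      by (intro bounded_linear_intros)
    show "((\<lambda>x. x \<bullet> x - 1) has_derivative blinfun_apply (2 *\<^sub>R blinfun_inner_left x)) (at x)"
      by (rule deriv)
    show "((\<lambda>x :: 'a. 2 *\<^sub>R blinfun_inner_left x) has_derivative
        blinfun_apply ((\<lambda>_. Blinfun (\<lambda>x. 2 *\<^sub>R blinfun_inner_left x)) x)) (at x)"
      unfolding bounded_linear_Blinfun_apply[OF bl] by (rule bounded_linear_imp_has_derivative[OF bl])
  qed (rule continuous_on_const)
  have reg: "\<forall>x\<in>- {0 :: 'a}. frechet_derivative (\<lambda>x. x \<bullet> x - 1) (at x) \<noteq> (\<lambda>_. 0)"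
  proof
    fix x :: 'a assume "x \<in> - {0}"
    then have "blinfun_apply (2 *\<^sub>R blinfun_inner_left x) x \<noteq> 0" by (simp add: scaleR_blinfun.rep_eq)
    then show "frechet_derivative (\<lambda>x. x \<bullet> x - 1) (at x) \<noteq> (\<lambda>_. 0)"
      unfolding frechet_derivative_at[OF deriv[of x], symmetric] by metis
  qed
  have "frontier (cball 0 1) \<inter> - {0} = {x \<in> - {0 :: 'a}. x \<bullet> x - 1 = 0}"
    by (auto simp: norm_eq_1)
  moreover have "open (- {0 :: 'a})" "p \<in> - {0}" using p by auto
  ultimately show "\<exists>U f. open U \<and> p \<in> U \<and> C2_on f U \<and>
      (\<forall>x\<in>U. frechet_derivative f (at x) \<noteq> (\<lambda>_. 0)) \<and> frontier (cball 0 1) \<inter> U = {x \<in> U. f x = 0}"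
    using C2 reg by blast
qed

text \<open>The approximation concerns a linear image of the ball; pulling the vertices back by the
  inverse map preserves hulls and the factor \<open>1 + \<epsilon>\<close>.\<close>

lemma n_bms_ball:
  assumes \<epsilon>: "0 < \<epsilon>"
  obtains V :: "(real ^ 'd) set" where "finite V" "card V \<le> n_bms TYPE('d) \<epsilon>"
    "V \<subseteq> cball 0 1" "cball 0 (inverse (1 + \<epsilon>)) \<subseteq> convex hull V"
proof -
  have "0 < measure lebesgue (cball 0 1 :: (real ^ 'd) set)"
    using content_cball_pos[of 1 "0 :: real ^ 'd"] by simp
  then obtain P \<Lambda> where P: "polytope (P :: (real ^ 'd) set)" "card {v. v extreme_point_of P} \<le> n_bms TYPE('d) \<epsilon>"
    and \<Lambda>: "linear (\<Lambda> :: real ^ 'd \<Rightarrow> real ^ 'd)" "bij \<Lambda>"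
    and sub: "P \<subseteq> \<Lambda> ` cball (0 :: real ^ 'd) 1" "\<Lambda> ` cball 0 1 \<subseteq> (\<lambda>x. (1 + \<epsilon>) *\<^sub>R x) ` P"
    using n_bms_attained[OF \<epsilon>, of "cball 0 1 :: (real ^ 'd) set"] C2_boundary_cball[where 'a = "real ^ 'd"] by auto
  define M where "M = inv \<Lambda>"
  have M: "linear M" unfolding M_def using \<Lambda> by (simp add: inj_linear_imp_inv_linear bij_is_inj)
  have inv: "M (\<Lambda> x) = x" "\<Lambda> (M x) = x" for x
    using \<Lambda>(2) by (simp_all add: M_def bij_is_inj bij_is_surj surj_f_inv_f)
  define E where "E = {v. v extreme_point_of P}"
  have E: "finite E" "E \<subseteq> P" unfolding E_def
    using finite_polyhedron_extreme_points polytope_imp_polyhedron P(1)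
    by (auto simp: extreme_point_of_def)
  have PE: "P = convex hull E"
    unfolding E_def using P(1) by (intro Krein_Milman_Minkowski polytope_imp_compact polytope_imp_convex)
  show thesis
  proof (rule that[of "M ` E"])
    show "finite (M ` E)" using E by simp
    show "card (M ` E) \<le> n_bms TYPE('d) \<epsilon>" using card_image_le[OF E(1), of M] P(2) by (simp add: E_def)
    show "M ` E \<subseteq> cball 0 1"
    proof clarify
      fix v assume "v \<in> E"
      then obtain x where "x \<in> cball 0 1" "v = \<Lambda> x" using E(2) sub(1) by blast
      then show "M v \<in> cball 0 1" by (simp add: inv)
    qed
    show "cball 0 (inverse (1 + \<epsilon>)) \<subseteq> convex hull (M ` E)"
    proof
      fix x :: "real ^ 'd" assume "x \<in> cball 0 (inverse (1 + \<epsilon>))"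
      then have "(1 + \<epsilon>) * norm x \<le> 1" using \<epsilon> by (simp add: field_simps)
      then have "(1 + \<epsilon>) *\<^sub>R x \<in> cball 0 1" using \<epsilon> by simp
      then obtain p where p: "p \<in> P" "\<Lambda> ((1 + \<epsilon>) *\<^sub>R x) = (1 + \<epsilon>) *\<^sub>R p" using sub(2) by blast
      then have "\<Lambda> x = p" using \<Lambda>(1) \<epsilon> by (simp add: linear_cmul)
      then have "x \<in> M ` P" using p(1) inv(1)[of x] by (intro image_eqI[of _ _ p]) auto
      then show "x \<in> convex hull (M ` E)" using M by (simp add: PE convex_hull_linear_image)
    qed
  qed
qed

section \<open>Partitions for sets with large convex hulls\<close>

text \<open>The hull of a Minkowski sum is the Minkowski sum of the hulls.\<close>

lemma weighted_sum_in_convex_hull: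
  fixes T :: "'i \<Rightarrow> 'a::real_vector set"
  assumes "finite A" "\<And>i. i \<in> A \<Longrightarrow> y i \<in> convex hull (T i)"
  shows "(\<Sum>i\<in>A. \<mu> i *\<^sub>R y i) \<in> convex hull {\<Sum>i\<in>A. \<mu> i *\<^sub>R x i | x. \<forall>i\<in>A. x i \<in> T i}"
proof -
  have "(\<Sum>i\<in>A. \<mu> i *\<^sub>R y i) \<in> (\<Sum>i\<in>A. convex hull ((\<lambda>x. \<mu> i *\<^sub>R x) ` T i))"
    using assms by (auto simp: set_sum_alt convex_hull_scaling)
  also have "\<dots> = convex hull (\<Sum>i\<in>A. (\<lambda>x. \<mu> i *\<^sub>R x) ` T i)" by (rule convex_hull_set_sum[symmetric])
  also have "\<dots> \<subseteq> convex hull {\<Sum>i\<in>A. \<mu> i *\<^sub>R x i | x. \<forall>i\<in>A. x i \<in> T i}"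
  proof (rule hull_mono, rule subsetI)
    fix z assume "z \<in> (\<Sum>i\<in>A. (\<lambda>x. \<mu> i *\<^sub>R x) ` T i)"
    then obtain s where s: "z = (\<Sum>i\<in>A. s i)" "\<forall>i\<in>A. s i \<in> (\<lambda>x. \<mu> i *\<^sub>R x) ` T i"
      using assms(1) by (auto simp: set_sum_alt)
    then have "\<forall>i\<in>A. \<exists>x. x \<in> T i \<and> s i = \<mu> i *\<^sub>R x" by auto
    then obtain x where x: "\<forall>i\<in>A. x i \<in> T i \<and> s i = \<mu> i *\<^sub>R x i" by metis
    then have "z = (\<Sum>i\<in>A. \<mu> i *\<^sub>R x i)" using s(1) by (auto intro: sum.cong)
    then show "z \<in> {\<Sum>i\<in>A. \<mu> i *\<^sub>R x i | x. \<forall>i\<in>A. x i \<in> T i}" using x by blast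
  qed
  finally show ?thesis .
qed

text \<open>A Tverberg partition of the centres into \<open>m * q\<close> classes turns the \<open>T i\<close> of a class into one set
  whose convex hull contains the unit ball around the Tverberg point \<open>p\<close>; the classes are then merged
  in blocks of \<open>q\<close>. All \<open>m\<close> resulting balls have the same centre \<open>p\<close>.\<close>

theorem tverberg_balls:
  fixes T :: "nat \<Rightarrow> 'a::euclidean_space set" and m q :: nat
  defines "n \<equiv> (m * q - 1) * (DIM('a) + 1) + 1"
  assumes m: "0 < m" and q: "0 < q"
    and select: "\<And>S :: nat \<Rightarrow> 'a set. (\<And>j. j < q \<Longrightarrow> cball 0 1 \<subseteq> convex hull (S j)) \<Longrightarrow>
        \<exists>s. (\<forall>j<q. s j \<in> S j) \<and> cball 0 R \<subseteq> convex hull (s ` {..<q})"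
    and T: "\<forall>i\<in>{1..n}. \<exists>c. cball c 1 \<subseteq> convex hull (T i)"
  shows "\<exists>t \<I>. (\<forall>i\<in>{1..n}. t i \<in> T i) \<and> partition_on {1..n} \<I> \<and> card \<I> = m \<and>
    (\<exists>c. cball c R \<subseteq> (\<Inter>I\<in>\<I>. convex hull (t ` I)))"
proof -
  obtain c where c: "\<And>i. i \<in> {1..n} \<Longrightarrow> cball (c i) 1 \<subseteq> convex hull (T i)" using T by metis
  define N where "N = {1..n}"
  have N: "finite N" by (simp add: N_def)
  have mq: "0 < m * q" using m q by simp
  have cardN: "(m * q - 1) * (DIM('a) + 1) < card N" by (simp add: N_def n_def)
  obtain k p \<mu> where k: "k \<in> N \<rightarrow> {..<m * q}" and \<mu>: "\<And>i. i \<in> N \<Longrightarrow> 0 \<le> \<mu> i"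
    "\<And>l. l < m * q \<Longrightarrow> (\<Sum>i | i \<in> N \<and> k i = l. \<mu> i) = 1"
    and p: "\<And>l. l < m * q \<Longrightarrow> (\<Sum>i | i \<in> N \<and> k i = l. \<mu> i *\<^sub>R c i) = p"
    by (rule tverberg[OF N mq cardN, where c = c]) (rule that; assumption)
  define X where "X l = {i. i \<in> N \<and> k i = l}" for l
  have X: "finite (X l)" "X l \<subseteq> N" for l using N by (auto simp: X_def)
  \<comment> \<open>With the Tverberg weights, which sum to 1, the unit balls around the
    \<open>c i\<close> add up to the unit ball around \<open>p\<close>.\<close>
  define S where "S l = {\<Sum>i\<in>X l. \<mu> i *\<^sub>R x i | x. \<forall>i\<in>X l. x i \<in> T i}" for l
  have S: "cball 0 1 \<subseteq> convex hull ((+) (- p) ` S l)" if l: "l < m * q" for l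
  proof
    fix y :: 'a assume y: "y \<in> cball 0 1"
    have "c i + y \<in> convex hull (T i)" if "i \<in> X l" for i
      using c[of i] y X(2)[of l] that by (auto simp: N_def subset_iff dist_norm)
    then have "(\<Sum>i\<in>X l. \<mu> i *\<^sub>R (c i + y)) \<in> convex hull (S l)"
      unfolding S_def using X by (intro weighted_sum_in_convex_hull)
    moreover have "(\<Sum>i\<in>X l. \<mu> i *\<^sub>R (c i + y)) = p + y"
      using \<mu>(2)[OF l] p[OF l] by (simp add: X_def scaleR_add_right sum.distrib scaleR_sum_left[symmetric])
    ultimately show "y \<in> convex hull ((+) (- p) ` S l)"
      unfolding convex_hull_translation by (intro image_eqI[of _ _ "p + y"]) auto
  qed
  \<comment> \<open>Class \<open>b * q + j\<close> is colour \<open>j\<close> of block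
    \<open>b\<close>; \<open>div\<close> and \<open>mod\<close> recover the pair.\<close>
  have "\<exists>s. (\<forall>j<q. s j \<in> (+) (- p) ` S (b * q + j)) \<and> cball 0 R \<subseteq> convex hull (s ` {..<q})"
    if b: "b < m" for b
  proof (rule select, rule S)
    fix j assume "j < q"
    then have "b * q + j < Suc b * q" by simp
    also have "\<dots> \<le> m * q" using b by (intro mult_le_mono1) simp
    finally show "b * q + j < m * q" .
  qed
  then obtain s where s: "\<And>b j. b < m \<Longrightarrow> j < q \<Longrightarrow> s b j \<in> (+) (- p) ` S (b * q + j)"
    "\<And>b. b < m \<Longrightarrow> cball 0 R \<subseteq> convex hull (s b ` {..<q})" by metis
  have "\<exists>x. (\<forall>i\<in>X l. x i \<in> T i) \<and> p + s (l div q) (l mod q) = (\<Sum>i\<in>X l. \<mu> i *\<^sub>R x i)"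
    if "l < m * q" for l
  proof -
    have "l div q < m" "l mod q < q" using that q by (auto simp: less_mult_imp_div_less)
    from s(1)[OF this] show ?thesis by (auto simp: S_def)
  qed
  then obtain x where x: "\<And>l i. l < m * q \<Longrightarrow> i \<in> X l \<Longrightarrow> x l i \<in> T i"
    "\<And>l. l < m * q \<Longrightarrow> p + s (l div q) (l mod q) = (\<Sum>i\<in>X l. \<mu> i *\<^sub>R x l i)" by metis
  \<comment> \<open>Each index belongs to exactly one class, so the selections made in the different
    classes never conflict.\<close>
  define t where "t i = x (k i) i" for i
  define B where "B b = {i \<in> N. k i div q = b}" for b
  have sB: "p + s b j \<in> convex hull (t ` B b)" if b: "b < m" and j: "j < q" for b j
  proof -
    define l where "l = b * q + j"
    have "l < Suc b * q" using j by (simp add: l_def)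
    also have "\<dots> \<le> m * q" using b by (intro mult_le_mono1) simp
    finally have l: "l < m * q" .
    have ldiv: "l div q = b" "l mod q = j" using j by (auto simp: l_def)
    have "p + s b j = (\<Sum>i\<in>X l. \<mu> i *\<^sub>R t i)"
      using x(2)[OF l] unfolding ldiv by (auto simp: t_def X_def intro: sum.cong)
    also have "\<dots> \<in> convex hull (t ` B b)"
      using X \<mu> l ldiv by (intro convex_sum) (auto simp: X_def B_def intro: hull_inc)
    finally show ?thesis .
  qed
  have ball: "cball p R \<subseteq> convex hull (t ` B b)" if b: "b < m" for b
  proof -
    have "(+) p ` cball 0 R \<subseteq> (+) p ` (convex hull (s b ` {..<q}))" using s(2)[OF b] by blast
    also have "\<dots> = convex hull ((+) p ` s b ` {..<q})" by (rule convex_hull_translation[symmetric])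
    also have "\<dots> \<subseteq> convex hull (t ` B b)" using sB[OF b] by (intro hull_minimal) auto
    finally show ?thesis by (simp add: cball_translation)
  qed
  \<comment> \<open>The weights of a class sum to 1, hence no class is empty; this makes the blocks
    \<open>m\<close> distinct parts of a partition.\<close>
  have B_ne: "B b \<noteq> {}" if b: "b < m" for b
  proof -
    have l: "b * q < m * q" using b q by simp
    have "X (b * q) \<noteq> {}" using \<mu>(2)[OF l] unfolding X_def by (metis sum.empty zero_neq_one)
    then show ?thesis using q by (auto simp: X_def B_def)
  qed
  have kdiv: "k i div q < m" if "i \<in> N" for i
  proof -
    have "k i < m * q" using k that by auto
    then show ?thesis by (rule less_mult_imp_div_less)
  qed
  have "inj_on B {..<m}"
  proof (rule inj_onI)
    fix b b' assume "b \<in> {..<m}" "B b = B b'"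
    then show "b = b'" using B_ne[of b] by (auto simp: B_def)
  qed
  then have "card (B ` {..<m}) = m" by (simp add: card_image)
  moreover have "partition_on N (B ` {..<m})"
  proof (rule partition_onI)
    show "\<Union> (B ` {..<m}) = N" using kdiv by (auto simp: B_def)
    show "disjnt P P'" if "P \<in> B ` {..<m}" "P' \<in> B ` {..<m}" "P \<noteq> P'" for P P'
      using that by (auto simp: B_def disjnt_def)
    show "{} \<notin> B ` {..<m}" using B_ne by fastforce
  qed
  moreover have "\<forall>i\<in>N. t i \<in> T i" using x(1) k by (auto simp: t_def X_def)
  moreover have "cball p R \<subseteq> (\<Inter>I\<in>B ` {..<m}. convex hull (t ` I))" using ball by auto
  ultimately show ?thesis unfolding N_def by blast
qed

theorem theorem4p1:
  fixes m :: nat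
  assumes "m > 0"
  shows "(let d = CARD('d::finite); n = (2 * d * m - 1) * (d + 1) + 1 in
            \<forall>T :: nat \<Rightarrow> (real ^ 'd) set.
              (\<forall>i\<in>{1..n}. \<exists>c. cball c 1 \<subseteq> convex hull (T i)) \<longrightarrow>
              (\<exists>t \<I>. (\<forall>i\<in>{1..n}. t i \<in> T i) \<and>
                 partition_on {1..n} \<I> \<and> card \<I> = m \<and>
                 (\<exists>c. cball c (pi / exp 1 ^ 2 * real d powi (- 2 * int d - 2))
                        \<subseteq> (\<Inter>I\<in>\<I>. convex hull (t ` I))))) \<and>
         (\<forall>\<epsilon>>0. let d = CARD('d); n' = n_bms TYPE('d) \<epsilon>;
                    n = (m * ((n' - 1) * d + 1) - 1) * (d + 1) + 1 in
            \<forall>T :: nat \<Rightarrow> (real ^ 'd) set.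
              (\<forall>i\<in>{1..n}. \<exists>c. cball c 1 \<subseteq> convex hull (T i)) \<longrightarrow>
              (\<exists>t \<I>. (\<forall>i\<in>{1..n}. t i \<in> T i) \<and>
                 partition_on {1..n} \<I> \<and> card \<I> = m \<and>
                 (\<exists>c. cball c (inverse (1 + \<epsilon>)) \<subseteq> (\<Inter>I\<in>\<I>. convex hull (t ` I)))))"
proof (intro conjI)
  show "let d = CARD('d); n = (2 * d * m - 1) * (d + 1) + 1 in
            \<forall>T :: nat \<Rightarrow> (real ^ 'd) set.
              (\<forall>i\<in>{1..n}. \<exists>c. cball c 1 \<subseteq> convex hull (T i)) \<longrightarrow>
              (\<exists>t \<I>. (\<forall>i\<in>{1..n}. t i \<in> T i) \<and>
                 partition_on {1..n} \<I> \<and> card \<I> = m \<and>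
                 (\<exists>c. cball c (pi / exp 1 ^ 2 * real d powi (- 2 * int d - 2))
                        \<subseteq> (\<Inter>I\<in>\<I>. convex hull (t ` I))))"
    unfolding Let_def
  proof (intro allI impI)
    fix T :: "nat \<Rightarrow> (real ^ 'd) set"
    define R where "R = pi / exp 1 ^ 2 * real CARD('d) powi (- 2 * int CARD('d) - 2)"
    have n: "(2 * CARD('d) * m - 1) * (CARD('d) + 1) + 1
        = (m * (2 * CARD('d)) - 1) * (DIM(real ^ 'd) + 1) + 1" by (simp add: mult_ac)
    have sel: "\<exists>s. (\<forall>j<2 * CARD('d). s j \<in> S j) \<and> cball 0 R \<subseteq> convex hull (s ` {..<2 * CARD('d)})"
      if "\<And>j. j < 2 * CARD('d) \<Longrightarrow> cball 0 1 \<subseteq> convex hull (S j)" for S :: "nat \<Rightarrow> (real ^ 'd) set"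
    proof -
      have "\<exists>s. (\<forall>j\<in>{..<2 * CARD('d)}. s j \<in> S j) \<and> cball 0 R \<subseteq> convex hull (s ` {..<2 * CARD('d)})"
        unfolding R_def by (rule colourful_steinitz) (simp_all add: that)
      then show ?thesis by (simp only: Ball_def lessThan_iff)
    qed
    assume T: "\<forall>i\<in>{1..(2 * CARD('d) * m - 1) * (CARD('d) + 1) + 1}. \<exists>c. cball c 1 \<subseteq> convex hull (T i)"
    show "\<exists>t \<I>. (\<forall>i\<in>{1..(2 * CARD('d) * m - 1) * (CARD('d) + 1) + 1}. t i \<in> T i) \<and>
        partition_on {1..(2 * CARD('d) * m - 1) * (CARD('d) + 1) + 1} \<I> \<and> card \<I> = m \<and>
        (\<exists>c. cball c (pi / exp 1 ^ 2 * real CARD('d) powi (- 2 * int CARD('d) - 2))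
           \<subseteq> (\<Inter>I\<in>\<I>. convex hull (t ` I)))"
      unfolding n R_def[symmetric]
      by (rule tverberg_balls[OF assms _ sel T[unfolded n]]) simp_all
  qed
  show "\<forall>\<epsilon>>0. let d = CARD('d); n' = n_bms TYPE('d) \<epsilon>;
                    n = (m * ((n' - 1) * d + 1) - 1) * (d + 1) + 1 in
            \<forall>T :: nat \<Rightarrow> (real ^ 'd) set.
              (\<forall>i\<in>{1..n}. \<exists>c. cball c 1 \<subseteq> convex hull (T i)) \<longrightarrow>
              (\<exists>t \<I>. (\<forall>i\<in>{1..n}. t i \<in> T i) \<and>
                 partition_on {1..n} \<I> \<and> card \<I> = m \<and>
                 (\<exists>c. cball c (inverse (1 + \<epsilon>)) \<subseteq> (\<Inter>I\<in>\<I>. convex hull (t ` I))))"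
    unfolding Let_def
  proof (intro allI impI)
    fix \<epsilon> :: real and T :: "nat \<Rightarrow> (real ^ 'd) set"
    assume \<epsilon>: "0 < \<epsilon>"
    \<comment> \<open>One colour supplies the point that covers a vertex by rotation; each of the
      remaining \<open>n' - 1\<close> vertices takes \<open>d\<close> colours.\<close>
    define q where "q = (n_bms TYPE('d) \<epsilon> - 1) * CARD('d) + 1"
    obtain V :: "(real ^ 'd) set" where V: "finite V" "card V \<le> n_bms TYPE('d) \<epsilon>"
      "V \<subseteq> cball 0 1" "cball 0 (inverse (1 + \<epsilon>)) \<subseteq> convex hull V" by (rule n_bms_ball[OF \<epsilon>])
    have "(card V - 1) * CARD('d) \<le> (n_bms TYPE('d) \<epsilon> - 1) * CARD('d)"
      using V(2) by (intro mult_le_mono1) simp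
    then have cardV: "(card V - 1) * CARD('d) < card {..<q}" unfolding q_def card_lessThan by linarith
    have sel: "\<exists>s. (\<forall>j<q. s j \<in> S j) \<and> cball 0 (inverse (1 + \<epsilon>)) \<subseteq> convex hull (s ` {..<q})"
      if "\<And>j. j < q \<Longrightarrow> cball 0 1 \<subseteq> convex hull (S j)" for S :: "nat \<Rightarrow> (real ^ 'd) set"
    proof -
      have "\<exists>s. (\<forall>j\<in>{..<q}. s j \<in> S j) \<and> cball 0 (inverse (1 + \<epsilon>)) \<subseteq> convex hull (s ` {..<q})"
        by (rule colourful_hull_contains_ball[OF V(1,3,4)]) (use cardV \<epsilon> in \<open>simp_all add: that\<close>)
      then show ?thesis by (simp only: Ball_def lessThan_iff)
    qed
    have n: "(m * q - 1) * (CARD('d) + 1) + 1 = (m * q - 1) * (DIM(real ^ 'd) + 1) + 1" by simp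
    assume T: "\<forall>i\<in>{1..(m * ((n_bms TYPE('d) \<epsilon> - 1) * CARD('d) + 1) - 1) * (CARD('d) + 1) + 1}.
      \<exists>c. cball c 1 \<subseteq> convex hull (T i)"
    show "\<exists>t \<I>. (\<forall>i\<in>{1..(m * ((n_bms TYPE('d) \<epsilon> - 1) * CARD('d) + 1) - 1) * (CARD('d) + 1) + 1}. t i \<in> T i) \<and>
        partition_on {1..(m * ((n_bms TYPE('d) \<epsilon> - 1) * CARD('d) + 1) - 1) * (CARD('d) + 1) + 1} \<I> \<and>
        card \<I> = m \<and> (\<exists>c. cball c (inverse (1 + \<epsilon>)) \<subseteq> (\<Inter>I\<in>\<I>. convex hull (t ` I)))"
      unfolding q_def[symmetric] n
      by (rule tverberg_balls[OF assms _ sel T[folded q_def, unfolded n]]) (simp_all add: q_def)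
  qed
qed

end
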